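(* Let $\mathbb{G}$ be a non-abelian directly indecomposable partially commutative group with generating set $A$, let $X=\{x_1,\dots,x_k\}$, $Y=\{y_1,\dots,y_k\}$, and let $S(X,Y,A)=1$ be an equation in the variables $X\cup Y$ with constants from $A^{\pm1}$. If $$\mathbb{G}\models \forall x_1\exists y_1\ldots\forall x_k\exists y_k\,(S(X,Y,A)=1),$$ then there exist words (with constants from $\mathbb{G}$) $q_1(x_1),\ldots,q_k(x_1,\ldots,x_k)\in\mathbb{G}[X]$ such that $$\mathbb{G}[X]\models S(x_1,q_1(x_1),\ldots,x_k,q_k(x_1,\ldots,x_k),A)=1,$$ i.e. the equation $S(x_1,y_1,\ldots,x_k,y_k,A)=1$ (in variables $Y$) has a solution in the group $\mathbb{G}[X]$.
   Context: Partially commutative group: given a finite, undirected, simple graph with vertex set $A=\{a_1,\dots,a_n\}$, it is the group $\mathbb{G}=\langle A \mid [a_i,a_j]=1 \text{ whenever } a_i,a_j \text{ are joined by an edge}\rangle$. It is directly indecomposable if it is not the direct product of two non-trivial groups. $\mathbb{G}[X]=\mathbb{G}*F(X)$ is the free product of $\mathbb{G}$ with the free group $F(X)$ on $X$; the word $q_i(x_1,\dots,x_i)$ is an element of $\mathbb{G}*F(x_1,\dots,x_i)\le\mathbb{G}[X]$. In the displayed conclusion, $x_1,\dots,x_k$ denote the free generators in $F(X)$. *)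

theory Defs
  imports "HOL-Algebra.Generated_Groups"
begin

section \<open>Group words and presentations\<close>

datatype 'a letter = Pos 'a | Neg 'a

type_synonym 'a gword = "'a letter list"

primrec flip :: "'a letter \<Rightarrow> 'a letter" where
  "flip (Pos a) = Neg a"
| "flip (Neg a) = Pos a"

definition gwords :: "'a set \<Rightarrow> 'a gword set" where
  "gwords A = lists (Pos ` A \<union> Neg ` A)"

primrec letter_val :: "('g, 'm) monoid_scheme \<Rightarrow> ('a \<Rightarrow> 'g) \<Rightarrow> 'a letter \<Rightarrow> 'g" where
  "letter_val G f (Pos a) = f a"
| "letter_val G f (Neg a) = inv\<^bsub>G\<^esub> (f a)"

definition word_val :: "('g, 'm) monoid_scheme \<Rightarrow> ('a \<Rightarrow> 'g) \<Rightarrow> 'a gword \<Rightarrow> 'g" where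
  "word_val G f w = foldr (\<lambda>l h. letter_val G f l \<otimes>\<^bsub>G\<^esub> h) w \<one>\<^bsub>G\<^esub>"

text \<open>The least monoid congruence on the words over \<open>A\<close> that cancels mutually inverse letters and
  trivialises the relators in \<open>R\<close>.\<close>

inductive pres_eq :: "'a set \<Rightarrow> 'a gword set \<Rightarrow> 'a gword \<Rightarrow> 'a gword \<Rightarrow> bool"
  for A :: "'a set" and R :: "'a gword set" where
  refl: "w \<in> gwords A \<Longrightarrow> pres_eq A R w w"
| sym: "pres_eq A R u v \<Longrightarrow> pres_eq A R v u"
| trans: "pres_eq A R u v \<Longrightarrow> pres_eq A R v w \<Longrightarrow> pres_eq A R u w"
| cong: "pres_eq A R u v \<Longrightarrow> p \<in> gwords A \<Longrightarrow> s \<in> gwords A \<Longrightarrow> pres_eq A R (p @ u @ s) (p @ v @ s)"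
| cancel: "[l] \<in> gwords A \<Longrightarrow> pres_eq A R [l, flip l] []"
| rel: "r \<in> R \<Longrightarrow> r \<in> gwords A \<Longrightarrow> pres_eq A R r []"

definition pres_rel :: "'a set \<Rightarrow> 'a gword set \<Rightarrow> 'a gword rel" where
  "pres_rel A R = {(u, v). pres_eq A R u v}"

text \<open>The group \<open>\<langle>A | R\<rangle>\<close>; its elements are the equivalence classes of words over \<open>A\<close>.\<close>

definition presented_group :: "'a set \<Rightarrow> 'a gword set \<Rightarrow> 'a gword set monoid" where
  "presented_group A R =
    \<lparr>carrier = gwords A // pres_rel A R,
     mult = (\<lambda>U V. \<Union>u\<in>U. \<Union>v\<in>V. pres_rel A R `` {u @ v}),
     one = pres_rel A R `` {[]}\<rparr>"

definition pres_gen :: "'a set \<Rightarrow> 'a gword set \<Rightarrow> 'a \<Rightarrow> 'a gword set" where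
  "pres_gen A R a = pres_rel A R `` {[Pos a]}"

lemma gwords_append [simp]: "u @ v \<in> gwords A \<longleftrightarrow> u \<in> gwords A \<and> v \<in> gwords A"
  by (simp add: gwords_def)

lemma gwords_Nil [simp]: "[] \<in> gwords A"
  by (simp add: gwords_def)

lemma gwords_Cons: "l # w \<in> gwords A \<longleftrightarrow> [l] \<in> gwords A \<and> w \<in> gwords A"
  by (simp add: gwords_def)

lemma gwords_flip: "[flip l] \<in> gwords A \<longleftrightarrow> [l] \<in> gwords A"
  by (cases l) (auto simp: gwords_def)

lemma flip_flip [simp]: "flip (flip l) = l"
  by (cases l) auto

lemma pres_eq_gwords: "pres_eq A R u v \<Longrightarrow> u \<in> gwords A \<and> v \<in> gwords A"
proof (induction rule: pres_eq.induct)
  case (cancel l)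
  then show ?case by (metis gwords_Cons gwords_Nil gwords_flip)
qed auto

lemma equiv_pres_rel: "equiv (gwords A) (pres_rel A R)"
proof (rule equivI)
  show "pres_rel A R \<subseteq> gwords A \<times> gwords A"
    using pres_eq_gwords by (fastforce simp: pres_rel_def)
  show "refl_on (gwords A) (pres_rel A R)"
    by (auto simp: refl_on_def pres_rel_def intro: pres_eq.refl)
  show "sym (pres_rel A R)"
    by (auto simp: sym_def pres_rel_def intro: pres_eq.sym)
  show "trans (pres_rel A R)"
    by (auto simp: trans_def pres_rel_def intro: pres_eq.trans)
qed

lemma pres_eq_append:
  assumes "pres_eq A R u u'" "pres_eq A R v v'"
  shows "pres_eq A R (u @ v) (u' @ v')"
proof -
  have "pres_eq A R ([] @ u @ v) ([] @ u' @ v)"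
    using pres_eq_gwords[OF assms(2)] by (intro pres_eq.cong assms(1)) auto
  moreover have "pres_eq A R (u' @ v @ []) (u' @ v' @ [])"
    using pres_eq_gwords[OF assms(1)] by (intro pres_eq.cong assms(2)) auto
  ultimately show ?thesis
    using pres_eq.trans[of A R "u @ v" "u' @ v"] by simp
qed

lemma pres_class_mult:
  assumes "u \<in> gwords A" "v \<in> gwords A"
  shows "pres_rel A R `` {u} \<otimes>\<^bsub>presented_group A R\<^esub> pres_rel A R `` {v} = pres_rel A R `` {u @ v}"
proof -
  have "congruent2 (pres_rel A R) (pres_rel A R) (\<lambda>u v. pres_rel A R `` {u @ v})"
    by (intro congruent2I' equiv_class_eq[OF equiv_pres_rel])
      (auto simp: pres_rel_def intro: pres_eq_append)
  then show ?thesis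
    using UN_equiv_class2[OF equiv_pres_rel equiv_pres_rel _ assms]
    by (simp add: presented_group_def)
qed

lemma pres_eq_inverse:
  "w \<in> gwords A \<Longrightarrow> pres_eq A R (rev (map flip w) @ w) []"
proof (induction w)
  case Nil
  then show ?case by (simp add: pres_eq.refl)
next
  case (Cons l w)
  then have l: "[l] \<in> gwords A" and w: "w \<in> gwords A"
    by (metis gwords_Cons)+
  have w': "rev (map flip w) \<in> gwords A"
    using pres_eq_gwords[OF Cons.IH[OF w]] by simp
  have "pres_eq A R [flip l, l] []"
    using pres_eq.cancel[of "flip l" A R] l by (simp add: gwords_flip)
  from pres_eq.cong[OF this w' w]
  have "pres_eq A R (rev (map flip (l # w)) @ l # w) (rev (map flip w) @ w)"
    by simp
  then show ?case
    using Cons.IH[OF w] by (rule pres_eq.trans)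
qed

lemma group_presented_group: "group (presented_group A R)"
proof (rule groupI)
  let ?G = "presented_group A R"
  have carrier: "carrier ?G = gwords A // pres_rel A R"
    and one: "\<one>\<^bsub>?G\<^esub> = pres_rel A R `` {[]}"
    by (simp_all add: presented_group_def)
  show "\<one>\<^bsub>?G\<^esub> \<in> carrier ?G"
    by (simp add: carrier one quotientI)
  show "x \<otimes>\<^bsub>?G\<^esub> y \<in> carrier ?G" if "x \<in> carrier ?G" "y \<in> carrier ?G" for x y
    using that by (auto simp: carrier pres_class_mult elim!: quotientE intro!: quotientI)
  show "x \<otimes>\<^bsub>?G\<^esub> y \<otimes>\<^bsub>?G\<^esub> z = x \<otimes>\<^bsub>?G\<^esub> (y \<otimes>\<^bsub>?G\<^esub> z)"
    if "x \<in> carrier ?G" "y \<in> carrier ?G" "z \<in> carrier ?G" for x y z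
    using that by (auto simp: carrier pres_class_mult elim!: quotientE)
  show "\<one>\<^bsub>?G\<^esub> \<otimes>\<^bsub>?G\<^esub> x = x" if "x \<in> carrier ?G" for x
    using that by (auto simp: carrier one pres_class_mult elim!: quotientE)
  show "\<exists>y\<in>carrier ?G. y \<otimes>\<^bsub>?G\<^esub> x = \<one>\<^bsub>?G\<^esub>" if x: "x \<in> carrier ?G" for x
  proof -
    from x obtain w where w: "w \<in> gwords A" "x = pres_rel A R `` {w}"
      by (auto simp: carrier elim: quotientE)
    have eq: "pres_eq A R (rev (map flip w) @ w) []"
      by (rule pres_eq_inverse[OF w(1)])
    have w': "rev (map flip w) \<in> gwords A"
      using pres_eq_gwords[OF eq] by simp
    have "pres_rel A R `` {rev (map flip w)} \<otimes>\<^bsub>?G\<^esub> x = \<one>\<^bsub>?G\<^esub>"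
      using eq w w'
      by (simp add: pres_class_mult one) (rule equiv_class_eq[OF equiv_pres_rel], simp add: pres_rel_def)
    then show ?thesis
      using w' by (auto simp: carrier intro: quotientI)
  qed
qed


section \<open>Free groups, free products and partially commutative groups\<close>

definition free_grp :: "'x set \<Rightarrow> 'x gword set monoid" where
  "free_grp X = presented_group X {}"

definition free_gen :: "'x set \<Rightarrow> 'x \<Rightarrow> 'x gword set" where
  "free_gen X = pres_gen X {}"

text \<open>The free product \<open>G * H\<close> is presented by the disjoint union of the carriers and the
  multiplication tables of both factors.\<close>

definition fp_rels ::
  "('g, 'm) monoid_scheme \<Rightarrow> ('h, 'n) monoid_scheme \<Rightarrow> ('g + 'h) gword set" where
  "fp_rels G H =
    {[Pos (Inl a), Pos (Inl b), Neg (Inl (a \<otimes>\<^bsub>G\<^esub> b))] | a b. a \<in> carrier G \<and> b \<in> carrier G} \<union>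
    {[Pos (Inr a), Pos (Inr b), Neg (Inr (a \<otimes>\<^bsub>H\<^esub> b))] | a b. a \<in> carrier H \<and> b \<in> carrier H}"

definition free_product ::
  "('g, 'm) monoid_scheme \<Rightarrow> ('h, 'n) monoid_scheme \<Rightarrow> ('g + 'h) gword set monoid" where
  "free_product G H = presented_group (carrier G <+> carrier H) (fp_rels G H)"

definition fp_inl ::
  "('g, 'm) monoid_scheme \<Rightarrow> ('h, 'n) monoid_scheme \<Rightarrow> 'g \<Rightarrow> ('g + 'h) gword set" where
  "fp_inl G H a = pres_gen (carrier G <+> carrier H) (fp_rels G H) (Inl a)"

definition fp_inr ::
  "('g, 'm) monoid_scheme \<Rightarrow> ('h, 'n) monoid_scheme \<Rightarrow> 'h \<Rightarrow> ('g + 'h) gword set" where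
  "fp_inr G H b = pres_gen (carrier G <+> carrier H) (fp_rels G H) (Inr b)"

definition finite_simple_graph :: "'a set \<Rightarrow> 'a set set \<Rightarrow> bool" where
  "finite_simple_graph A E \<longleftrightarrow> finite A \<and> (\<forall>e\<in>E. e \<subseteq> A \<and> card e = 2)"

definition commutator_rels :: "'a set set \<Rightarrow> 'a gword set" where
  "commutator_rels E = {[Pos a, Pos b, Neg a, Neg b] | a b. {a, b} \<in> E}"

definition pc_group :: "'a set \<Rightarrow> 'a set set \<Rightarrow> 'a gword set monoid" where
  "pc_group A E = presented_group A (commutator_rels E)"

definition pc_gen :: "'a set \<Rightarrow> 'a set set \<Rightarrow> 'a \<Rightarrow> 'a gword set" where
  "pc_gen A E = pres_gen A (commutator_rels E)"

text \<open>The factors range over groups on the element type of \<open>G\<close>. This is no restriction, since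
  each factor is isomorphic to a subgroup of \<open>G\<close>; see \<open>directly_indecomposable_any_type\<close>.\<close>

definition directly_indecomposable :: "('g, 'm) monoid_scheme \<Rightarrow> bool" where
  "directly_indecomposable G \<longleftrightarrow>
    \<not> (\<exists>(H :: 'g monoid) (K :: 'g monoid). group H \<and> group K \<and>
         carrier H \<noteq> {\<one>\<^bsub>H\<^esub>} \<and> carrier K \<noteq> {\<one>\<^bsub>K\<^esub>} \<and> H \<times>\<times> K \<cong> G)"

lemma group_copy:
  fixes f :: "'h \<Rightarrow> 'g"
  assumes "group H" "inj_on f (carrier H)"
  obtains H' :: "'g monoid" where "group H'" "f \<in> iso H H'" "carrier H' = f ` carrier H"
    "\<one>\<^bsub>H'\<^esub> = f \<one>\<^bsub>H\<^esub>"
proof -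
  interpret H: group H by fact
  let ?g = "inv_into (carrier H) f"
  let ?H' = "\<lparr>carrier = f ` carrier H, mult = (\<lambda>x y. f (?g x \<otimes>\<^bsub>H\<^esub> ?g y)), one = f \<one>\<^bsub>H\<^esub>\<rparr>"
  have "f \<in> iso H ?H'"
    using assms(2) by (auto simp: iso_def hom_def bij_betw_def)
  moreover from this have "group ?H'"
    using H.iso_imp_img_group[of f ?H'] by simp
  ultimately show thesis
    using that[of ?H'] by simp
qed

lemma directly_indecomposable_any_type:
  fixes G :: "('g, 'l) monoid_scheme" and H :: "('h, 'm) monoid_scheme" and K :: "('k, 'n) monoid_scheme"
  assumes "group G" "directly_indecomposable G" "group H" "group K" "H \<times>\<times> K \<cong> G"
  shows "carrier H = {\<one>\<^bsub>H\<^esub>} \<or> carrier K = {\<one>\<^bsub>K\<^esub>}"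
proof (rule ccontr)
  assume "\<not> ?thesis"
  then have nontriv: "carrier H \<noteq> {\<one>\<^bsub>H\<^esub>}" "carrier K \<noteq> {\<one>\<^bsub>K\<^esub>}"
    by auto
  interpret H: group H by fact
  interpret K: group K by fact
  obtain \<phi> where \<phi>: "\<phi> \<in> iso (H \<times>\<times> K) G"
    using assms(5) by (auto simp: is_iso_def)
  then have inj: "inj_on \<phi> (carrier H \<times> carrier K)"
    by (simp add: iso_def bij_betw_def)
  have injH: "inj_on (\<lambda>h. \<phi> (h, \<one>\<^bsub>K\<^esub>)) (carrier H)"
    using inj H.one_closed K.one_closed unfolding inj_on_def by blast
  have injK: "inj_on (\<lambda>h. \<phi> (\<one>\<^bsub>H\<^esub>, h)) (carrier K)"
    using inj H.one_closed K.one_closed unfolding inj_on_def by blast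
  obtain H' :: "'g monoid" where H': "group H'" "(\<lambda>h. \<phi> (h, \<one>\<^bsub>K\<^esub>)) \<in> iso H H'"
      "carrier H' = (\<lambda>h. \<phi> (h, \<one>\<^bsub>K\<^esub>)) ` carrier H" "\<one>\<^bsub>H'\<^esub> = \<phi> (\<one>\<^bsub>H\<^esub>, \<one>\<^bsub>K\<^esub>)"
    using group_copy[OF assms(3) injH] by blast
  obtain K' :: "'g monoid" where K': "group K'" "(\<lambda>h. \<phi> (\<one>\<^bsub>H\<^esub>, h)) \<in> iso K K'"
      "carrier K' = (\<lambda>h. \<phi> (\<one>\<^bsub>H\<^esub>, h)) ` carrier K" "\<one>\<^bsub>K'\<^esub> = \<phi> (\<one>\<^bsub>H\<^esub>, \<one>\<^bsub>K\<^esub>)"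
    using group_copy[OF assms(4) injK] by blast
  have "carrier H' \<noteq> {\<one>\<^bsub>H'\<^esub>}"
  proof -
    obtain h where h: "h \<in> carrier H" "h \<noteq> \<one>\<^bsub>H\<^esub>"
      using nontriv(1) H.one_closed by blast
    then have "\<phi> (h, \<one>\<^bsub>K\<^esub>) \<noteq> \<phi> (\<one>\<^bsub>H\<^esub>, \<one>\<^bsub>K\<^esub>)"
      using inj_onD[OF injH _ h(1) H.one_closed] by blast
    then show ?thesis
      using h(1) unfolding H'(3,4) by blast
  qed
  moreover have "carrier K' \<noteq> {\<one>\<^bsub>K'\<^esub>}"
  proof -
    obtain h where h: "h \<in> carrier K" "h \<noteq> \<one>\<^bsub>K\<^esub>"
      using nontriv(2) K.one_closed by blast
    then have "\<phi> (\<one>\<^bsub>H\<^esub>, h) \<noteq> \<phi> (\<one>\<^bsub>H\<^esub>, \<one>\<^bsub>K\<^esub>)"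
      using inj_onD[OF injK _ h(1) K.one_closed] by blast
    then show ?thesis
      using h(1) unfolding K'(3,4) by blast
  qed
  moreover have "H' \<times>\<times> K' \<cong> G"
  proof -
    have "H \<times>\<times> K \<cong> H' \<times>\<times> K'"
      using H' K' assms(3,4) by (intro is_isoI) (rule iso_paired2[THEN iffD2], auto)
    then show ?thesis
      using group.iso_sym[OF DirProd_group[OF assms(3,4)]] assms(5) iso_trans by blast
  qed
  ultimately show False
    using assms(2) H'(1) K'(1) unfolding directly_indecomposable_def by blast
qed


section \<open>Equations with coefficients and the quantifier prefix\<close>

text \<open>The variables are numbered from \<open>0\<close>: \<open>VarX i\<close> and \<open>VarY i\<close> stand for
  $x_{i+1}$ and $y_{i+1}$, and $x_{i+1}$, $y_{i+1}$ take the values \<open>xs ! i\<close>, \<open>ys ! i\<close>.\<close>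

datatype 'a eqn_symbol = VarX nat | VarY nat | Const 'a

definition eqn_symbols :: "nat \<Rightarrow> 'a set \<Rightarrow> 'a eqn_symbol set" where
  "eqn_symbols k A = VarX ` {..<k} \<union> VarY ` {..<k} \<union> Const ` A"

primrec assign :: "('a \<Rightarrow> 'g) \<Rightarrow> 'g list \<Rightarrow> 'g list \<Rightarrow> 'a eqn_symbol \<Rightarrow> 'g" where
  "assign c xs ys (VarX i) = xs ! i"
| "assign c xs ys (VarY i) = ys ! i"
| "assign c xs ys (Const a) = c a"

text \<open>\<open>forall_exists D k \<Phi>\<close> unfolds to
  $\forall x_1\,\exists y_1 \ldots \forall x_k\,\exists y_k\;\Phi\,[x_1,\ldots,x_k]\,[y_1,\ldots,y_k]$
  with all quantifiers ranging over \<open>D\<close>.\<close>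

primrec forall_exists :: "'g set \<Rightarrow> nat \<Rightarrow> ('g list \<Rightarrow> 'g list \<Rightarrow> bool) \<Rightarrow> bool" where
  "forall_exists D 0 \<Phi> = \<Phi> [] []"
| "forall_exists D (Suc k) \<Phi> =
    (\<forall>x\<in>D. \<exists>y\<in>D. forall_exists D k (\<lambda>xs ys. \<Phi> (x # xs) (y # ys)))"

end

theory Submission
  imports Defs
begin

text \<open>
  The proof inserts free generators into elements of \<open>\<bbbG>\<close> at suitable places, in such a way that one
  given computation in \<open>\<bbbG>\<close> remains valid in \<open>\<bbbG>[X]\<close>.

  Fix a vertex \<open>a\<close> and let \<open>C\<close> be the subgroup generated by its neighbours. Then \<open>\<bbbG>\<close> is an HNN
  extension with stable letter \<open>a\<close> commuting with \<open>C\<close>, and \<open>g\<close> determines a geodesic in the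
  Bass--Serre tree, whose edges are cosets of \<open>C\<close>. The tree itself is not built: the geodesic of \<open>g\<close>
  is a reduced word \<open>path g\<close> in the free group on the cosets of \<open>C\<close>, and \<open>path\<close> is the crossed
  homomorphism that sends \<open>a\<close> to the generator \<open>C\<close> and the other vertices to \<open>1\<close>. It exists because it
  respects the defining commutators, and free reduction supplies the tripods of the tree.

  Take elements \<open>t n\<close> of the form \<open>a h n\<close>, where \<open>h n\<close> does not involve \<open>a\<close>, and call
  the translates of the pair of consecutive edges \<open>C\<close>, \<open>t n C\<close> corners of index \<open>n\<close>. Choose the \<open>t n\<close> such
  that a corner determines its index and the translating element. For a family \<open>z\<close> in \<open>\<bbbG>[X]\<close>, the map
  \<open>insertion z\<close> inserts \<open>z n\<close> into \<open>g\<close> at every corner of index \<open>n\<close> on its path (and the inverse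
  where the corner is traversed backwards). In a product \<open>g h\<close> the three paths form a tripod, and
  only the three corners at the branch point can spoil multiplicativity; so \<open>insertion z\<close> is
  multiplicative on \<open>g\<close> and \<open>h\<close> unless \<open>z\<close> is non-trivial at one of at most three
  indices (\<open>insertion_mult\<close>). Hence evaluating the word \<open>S\<close> commutes with \<open>insertion z\<close> outside at most
  \<open>3 |S|\<close> bad indices (\<open>insertion_word_val\<close>).

  Now let the universal player choose for each \<open>x\<^sub>i\<close> a product of \<open>3 |S| + 1\<close> elements \<open>t m\<close> whose
  indices are new to everything that was played before. After the play, some index \<open>n\<^sub>i\<close>
  used in \<open>x\<^sub>i\<close> is not bad, and its corner occurs there once. Putting \<open>z\<close> equal to \<open>1\<close> outside these
  indices and solving for \<open>z n\<^sub>i\<close>, one gets a map that sends the value of \<open>x\<^sub>i\<close> to the free generator \<open>x\<^sub>i\<close>,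
  fixes the coefficients, and preserves the equation. As \<open>n\<^sub>j\<close> with \<open>j > i\<close> is new to \<open>y\<^sub>i\<close>, the image of
  \<open>y\<^sub>i\<close> lies in the subgroup generated by \<open>\<bbbG>\<close> and \<open>x\<^sub>1, \<dots>, x\<^sub>i\<close>. These images are the words
  \<open>q\<^sub>i\<close> (\<open>formal_solution\<close>).

  It remains to find the elements \<open>t n\<close> (\<open>corner_elements\<close>), and this is where the hypotheses on \<open>\<bbbG>\<close> enter.
  As \<open>\<bbbG>\<close> is not abelian, \<open>a\<close> can be chosen such that some other vertex \<open>b\<close> is not joined to it; as \<open>\<bbbG>\<close> is directly
  indecomposable, the complement of the graph is connected, and the other vertices can be listed as
  \<open>b\<^sub>1, \<dots>, b\<^sub>r\<close> so that each of them is not joined to \<open>a\<close> or to an earlier one. Let \<open>p = b\<^sub>1 \<dots> b\<^sub>r b\<^sub>r \<dots> b\<^sub>1\<close>. An equation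
  \<open>x p = p y\<close> with \<open>x\<close> and \<open>y\<close> in \<open>C\<close> can be peeled from both ends, by comparing the paths for the
  letters \<open>b\<^sub>1, b\<^sub>2, \<dots>\<close>, which puts \<open>x\<close> into the subgroup generated by the neighbours of \<open>c\<close>, for every vertex \<open>c\<close>;
  so \<open>x = 1\<close>. One takes \<open>h n = b\<^sup>n p\<close>, and the number of occurrences of \<open>b\<close> tells the indices apart.
\<close>

section \<open>Words and their values\<close>

lemma gwords_iff: "w \<in> gwords A \<longleftrightarrow> (\<forall>l\<in>set w. set_letter l \<subseteq> A)"
proof -
  have "l \<in> Pos ` A \<union> Neg ` A \<longleftrightarrow> set_letter l \<subseteq> A" for l
    by (cases l) auto
  then show ?thesis by (auto simp: gwords_def in_lists_conv_set)
qed

lemma (in group) letter_val_closed: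
  "f ` V \<subseteq> carrier G \<Longrightarrow> set_letter l \<subseteq> V \<Longrightarrow> letter_val G f l \<in> carrier G"
  by (cases l) auto

lemma word_val_Nil [simp]: "word_val G f [] = \<one>\<^bsub>G\<^esub>"
  by (simp add: word_val_def)

lemma word_val_Cons [simp]: "word_val G f (l # w) = letter_val G f l \<otimes>\<^bsub>G\<^esub> word_val G f w"
  by (simp add: word_val_def)

lemma (in group) word_val_closed:
  "f ` V \<subseteq> carrier G \<Longrightarrow> w \<in> gwords V \<Longrightarrow> word_val G f w \<in> carrier G"
  by (induction w) (auto simp: gwords_iff letter_val_closed)

lemma (in group) word_val_append:
  assumes "f ` V \<subseteq> carrier G" "u \<in> gwords V" "v \<in> gwords V"
  shows "word_val G f (u @ v) = word_val G f u \<otimes> word_val G f v"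
  using assms(2)
proof (induction u)
  case (Cons l u)
  then have "u \<in> gwords V" "letter_val G f l \<in> carrier G"
    using letter_val_closed[OF assms(1)] by (auto simp: gwords_iff)
  then show ?case
    using Cons.IH word_val_closed[OF assms(1)] assms(3) by (simp add: m_assoc)
qed (simp add: word_val_closed[OF assms(1,3)])

lemma word_val_cong:
  assumes "w \<in> gwords V" "\<And>v. v \<in> V \<Longrightarrow> f v = f' v"
  shows "word_val G f w = word_val G f' w"
  using assms(1)
proof (induction w)
  case (Cons l w)
  then have "letter_val G f l = letter_val G f' l"
    using assms(2) by (cases l) (auto simp: gwords_iff)
  then show ?case using Cons by (simp add: gwords_iff)
qed simp

section \<open>Free reduction\<close>

text \<open>Left multiplication of a reduced word by a letter in the free group.\<close>

definition free_cons :: "'e letter \<Rightarrow> 'e gword \<Rightarrow> 'e gword" where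
  "free_cons l xs = (case xs of [] \<Rightarrow> [l] | y # ys \<Rightarrow> if y = flip l then ys else l # xs)"

abbreviation freely_reduced :: "'e gword \<Rightarrow> bool" where
  "freely_reduced \<equiv> successively (\<lambda>x y. y \<noteq> flip x)"

definition inv_word :: "'e gword \<Rightarrow> 'e gword" where
  "inv_word w = rev (map flip w)"

lemma freely_reduced_free_cons: "freely_reduced xs \<Longrightarrow> freely_reduced (free_cons l xs)"
  by (auto simp: free_cons_def successively_Cons split: list.splits)

lemma freely_reduced_foldr: "freely_reduced ys \<Longrightarrow> freely_reduced (foldr free_cons xs ys)"
  by (induction xs) (auto intro: freely_reduced_free_cons)

lemma free_cons_cancel: "freely_reduced xs \<Longrightarrow> free_cons l (free_cons (flip l) xs) = xs"
  by (auto simp: free_cons_def successively_Cons split: list.splits)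

lemma foldr_free_cons:
  assumes "freely_reduced ys"
  shows "foldr free_cons (free_cons l xs) ys = free_cons l (foldr free_cons xs ys)"
proof (cases xs)
  case (Cons x xs')
  then show ?thesis
    using free_cons_cancel[OF freely_reduced_foldr[OF assms], of l]
    by (auto simp: free_cons_def)
qed (auto simp: free_cons_def)

lemma foldr_foldr_free_cons:
  "freely_reduced ys \<Longrightarrow>
    foldr free_cons (foldr free_cons us xs) ys = foldr free_cons us (foldr free_cons xs ys)"
  by (induction us) (simp_all add: foldr_free_cons)

lemma foldr_free_cons_Pos:
  assumes "\<forall>l\<in>set us \<union> set vs. \<exists>U. l = Pos U"
  shows "foldr free_cons us vs = us @ vs"
  using assms
proof (induction us)
  case (Cons u us)
  then obtain U where "u = Pos U" by auto
  moreover have "foldr free_cons us vs = us @ vs" using Cons by simp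
  moreover have "y \<noteq> Neg U" if "us @ vs = y # ys" for y ys
    using that Cons.prems by (cases us) auto
  ultimately have "free_cons u (us @ vs) = u # us @ vs"
    by (cases "us @ vs") (auto simp: free_cons_def)
  then show ?case using \<open>foldr free_cons us vs = us @ vs\<close> by simp
qed simp

text \<open>The product of two elements of a free group: the three reduced words are the sides of a tripod, and
\<open>q\<close> is the part that cancels.\<close>

lemma foldr_free_cons_tripod:
  assumes "freely_reduced u"
  shows "\<exists>p q r. u = p @ q \<and> v = inv_word q @ r \<and> foldr free_cons u v = p @ r"
  using assms
proof (induction u)
  case Nil
  then show ?case by (auto simp: inv_word_def)
next
  case (Cons l u)
  then obtain p q r where IH: "u = p @ q" "v = inv_word q @ r" "foldr free_cons u v = p @ r"
    by (auto simp: successively_Cons)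
  show ?case
  proof (cases "p = [] \<and> r \<noteq> [] \<and> hd r = flip l")
    case True
    then obtain r' where r: "r = flip l # r'" by (cases r) auto
    have "l # u = [] @ (l # u)" "v = inv_word (l # u) @ r'" "foldr free_cons (l # u) v = [] @ r'"
      using IH True r by (auto simp: inv_word_def free_cons_def)
    then show ?thesis by blast
  next
    case False
    have "free_cons l (p @ r) = l # p @ r"
      using False IH(1) Cons.prems
      by (cases p; cases r) (auto simp: free_cons_def)
    then have "l # u = (l # p) @ q" "foldr free_cons (l # u) v = (l # p) @ r"
      using IH by auto
    then show ?thesis using IH(2) by blast
  qed
qed

lemma map_letter_flip: "map_letter f (flip l) = flip (map_letter f l)"
  by (cases l) auto

lemma inj_map_letter:
  assumes "inj_on f A" "set_letter l \<subseteq> A" "set_letter l' \<subseteq> A"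
  shows "map_letter f l = map_letter f l' \<longleftrightarrow> l = l'"
  using assms by (cases l; cases l') (auto dest: inj_onD)

lemma set_letter_flip [simp]: "set_letter (flip l) = set_letter l"
  by (cases l) auto

lemma map_free_cons:
  assumes "inj_on f A" "set_letter l \<subseteq> A" "xs \<in> gwords A"
  shows "map (map_letter f) (free_cons l xs) = free_cons (map_letter f l) (map (map_letter f) xs)"
proof (cases xs)
  case (Cons x xs')
  then have "set_letter x \<subseteq> A"
    using assms(3) by (simp add: gwords_iff)
  then have "map_letter f x = flip (map_letter f l) \<longleftrightarrow> x = flip l"
    using inj_map_letter[OF assms(1), of x "flip l"] assms(2) by (simp add: map_letter_flip)
  then show ?thesis using Cons by (auto simp: free_cons_def)
qed (simp add: free_cons_def)

lemma free_cons_gwords: "set_letter l \<subseteq> A \<Longrightarrow> xs \<in> gwords A \<Longrightarrow> free_cons l xs \<in> gwords A"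
  by (auto simp: free_cons_def gwords_iff split: list.splits)

lemma foldr_free_cons_gwords: "u \<in> gwords A \<Longrightarrow> v \<in> gwords A \<Longrightarrow> foldr free_cons u v \<in> gwords A"
proof (induction u)
  case (Cons l u)
  then have "set_letter l \<subseteq> A" "u \<in> gwords A" by (auto simp: gwords_iff)
  then show ?case using Cons.IH[OF _ Cons.prems(2)] by (simp add: free_cons_gwords)
qed simp

lemma map_foldr_free_cons:
  assumes "inj_on f A" "u \<in> gwords A" "v \<in> gwords A"
  shows "map (map_letter f) (foldr free_cons u v)
    = foldr free_cons (map (map_letter f) u) (map (map_letter f) v)"
  using assms(2)
proof (induction u)
  case (Cons l u)
  then have "set_letter l \<subseteq> A" "u \<in> gwords A" by (auto simp: gwords_iff)
  then show ?case
    using Cons.IH map_free_cons[OF assms(1) _ foldr_free_cons_gwords[OF _ assms(3)], of l u]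
    by simp
qed simp

lemma freely_reduced_map:
  assumes "inj_on f A" "u \<in> gwords A" "freely_reduced u"
  shows "freely_reduced (map (map_letter f) u)"
proof -
  have "successively (\<lambda>x y. map_letter f y \<noteq> flip (map_letter f x)) u"
  proof (rule successively_mono[OF assms(3)])
    fix x y assume "x \<in> set u" "y \<in> set u" "y \<noteq> flip x"
    then show "map_letter f y \<noteq> flip (map_letter f x)"
      using inj_map_letter[OF assms(1), of y "flip x"] assms(2)
      by (simp add: map_letter_flip gwords_iff)
  qed
  then show ?thesis by (simp add: successively_map)
qed

section \<open>Crossed homomorphisms into free groups\<close>

text \<open>The set \<open>Edges\<close> plays the role of the positively oriented edges of a tree; \<open>Neg u\<close> is the edge \<open>u\<close>
traversed backwards. For a partially commutative group these will be the cosets of a subgroup.\<close>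

locale edge_action = group G for G :: "('g, 'm) monoid_scheme" (structure) +
  fixes act :: "'g \<Rightarrow> 'e \<Rightarrow> 'e" and Edges :: "'e set"
  assumes act_closed: "g \<in> carrier G \<Longrightarrow> u \<in> Edges \<Longrightarrow> act g u \<in> Edges"
    and act_one: "u \<in> Edges \<Longrightarrow> act \<one> u = u"
    and act_mult: "g \<in> carrier G \<Longrightarrow> h \<in> carrier G \<Longrightarrow> u \<in> Edges \<Longrightarrow> act (g \<otimes> h) u = act g (act h u)"
begin

abbreviation translate :: "'g \<Rightarrow> 'e gword \<Rightarrow> 'e gword" where
  "translate g \<equiv> map (map_letter (act g))"

lemma act_inv: "g \<in> carrier G \<Longrightarrow> u \<in> Edges \<Longrightarrow> act (inv g) (act g u) = u"
  using act_mult[of "inv g" g u] by (simp add: act_one)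

lemma inj_act: "g \<in> carrier G \<Longrightarrow> inj_on (act g) Edges"
  by (metis act_inv inj_onI)

lemma translate_one: "xs \<in> gwords Edges \<Longrightarrow> translate \<one> xs = xs"
proof (induction xs)
  case (Cons l xs)
  then show ?case by (cases l) (auto simp: gwords_iff act_one)
qed simp

lemma translate_mult:
  "g \<in> carrier G \<Longrightarrow> h \<in> carrier G \<Longrightarrow> xs \<in> gwords Edges \<Longrightarrow>
    translate (g \<otimes> h) xs = translate g (translate h xs)"
proof (induction xs)
  case (Cons l xs)
  then show ?case by (cases l) (auto simp: gwords_iff act_mult)
qed simp

lemma translate_gwords:
  assumes "g \<in> carrier G" "xs \<in> gwords Edges" shows "translate g xs \<in> gwords Edges"
proof -
  have "set_letter (map_letter (act g) l) \<subseteq> Edges" if "set_letter l \<subseteq> Edges" for l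
    using that assms(1) by (cases l) (auto intro: act_closed)
  then show ?thesis using assms(2) by (auto simp: gwords_iff)
qed

end

text \<open>A group acting on a tree, reduced to what the argument needs: \<open>path g\<close> stands for the geodesic from a base
vertex to its image under \<open>g\<close>. The last assumption says that \<open>path\<close> is a crossed homomorphism into the
free group on the edges, which holds because the geodesic of a product is the
reduced form of the geodesic of \<open>g\<close> followed by the \<open>g\<close>-translate of that of \<open>h\<close>.\<close>

locale edge_cocycle = edge_action G act Edges
  for G :: "('g, 'm) monoid_scheme" (structure) and act :: "'g \<Rightarrow> 'e \<Rightarrow> 'e" and Edges +
  fixes path :: "'g \<Rightarrow> 'e gword"
  assumes path_edges: "g \<in> carrier G \<Longrightarrow> path g \<in> gwords Edges"
    and path_reduced: "g \<in> carrier G \<Longrightarrow> freely_reduced (path g)"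
    and path_mult: "g \<in> carrier G \<Longrightarrow> h \<in> carrier G \<Longrightarrow>
      path (g \<otimes> h) = foldr free_cons (path g) (translate g (path h))"
begin

lemma path_tripod:
  assumes "g \<in> carrier G" "h \<in> carrier G"
  obtains p q r where "path g = p @ q" "translate g (path h) = inv_word q @ r"
    "path (g \<otimes> h) = p @ r"
  using foldr_free_cons_tripod[OF path_reduced[OF assms(1)]] path_mult[OF assms] by metis

lemma path_one: "path \<one> = []"
proof -
  obtain p q r where "path \<one> = p @ q" "translate \<one> (path \<one>) = inv_word q @ r"
    "path (\<one> \<otimes> \<one>) = p @ r"
    using path_tripod[of \<one> \<one>] by auto
  then have *: "path \<one> = p @ q" "p @ q = inv_word q @ r" "q = r"
    using translate_one[OF path_edges[of \<one>]] by auto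
  then have "p = inv_word q" "path \<one> = inv_word q @ q"
    by (auto simp: inv_word_def)
  then have "q = []"
    using path_reduced[of \<one>]
    by (cases q) (auto simp: inv_word_def successively_append_iff)
  then show ?thesis using * by (simp add: inv_word_def)
qed

lemma path_inv:
  assumes "g \<in> carrier G"
  shows "path (inv g) = inv_word (translate (inv g) (path g))"
proof -
  obtain p q r where *: "path (inv g) = p @ q" "translate (inv g) (path g) = inv_word q @ r"
    "path (inv g \<otimes> g) = p @ r"
    using path_tripod[of "inv g" g] assms by auto
  then have "p = []" "r = []" using path_one assms by auto
  then show ?thesis using * by (auto simp: inv_word_def rev_map comp_def)
qed

end

section \<open>Insertion at corners\<close>

text \<open>Translates of the pair of edges \<open>e\<close>, \<open>t n e\<close> are the places where something gets inserted. By
\<open>corner_free\<close>, such a pair determines both \<open>n\<close> and the translating element, so that there is a definite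
conjugate of \<open>z n\<close> to insert. The target \<open>K\<close> stands for \<open>\<bbbG>[X]\<close> and \<open>\<iota>\<close> for the
inclusion of \<open>\<bbbG>\<close>.\<close>

locale corner_family = edge_cocycle G act Edges path + K: group K
  for G :: "('g, 'm) monoid_scheme" (structure) and act :: "'g \<Rightarrow> 'e \<Rightarrow> 'e" and Edges path
    and K :: "('k, 'n) monoid_scheme" +
  fixes \<iota> :: "'g \<Rightarrow> 'k" and e :: 'e and t :: "nat \<Rightarrow> 'g"
  assumes \<iota>: "\<iota> \<in> hom G K"
    and base_edge: "e \<in> Edges"
    and t_closed: "t n \<in> carrier G"
    and path_t: "path (t n) = [Pos e]"
    and corner_free: "g \<in> carrier G \<Longrightarrow> act g e = e \<Longrightarrow> act g (act (t m) e) = act (t n) e \<Longrightarrow>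
      m = n \<and> g = \<one>"
begin

sublocale hom_\<iota>: group_hom G K \<iota>
  by unfold_locales (rule \<iota>)

definition is_corner :: "'e \<Rightarrow> 'e \<Rightarrow> 'g \<Rightarrow> nat \<Rightarrow> bool" where
  "is_corner u v g n \<longleftrightarrow> g \<in> carrier G \<and> u = act g e \<and> v = act g (act (t n) e)"

lemma is_corner_unique:
  assumes "is_corner u v g m" "is_corner u v h n"
  shows "g = h \<and> m = n"
proof -
  have gh: "g \<in> carrier G" "h \<in> carrier G" and eq: "act g e = act h e"
    "act g (act (t m) e) = act h (act (t n) e)"
    using assms by (auto simp: is_corner_def)
  have "act (inv h \<otimes> g) e = e" "act (inv h \<otimes> g) (act (t m) e) = act (t n) e"
    using gh eq base_edge by (simp_all add: act_mult act_inv act_closed t_closed)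
  then have "m = n" "inv h \<otimes> g = \<one>"
    using corner_free[of "inv h \<otimes> g"] gh by auto
  then show ?thesis
    using gh by (metis inv_equality inv_inv inv_closed)
qed

definition corner_val :: "(nat \<Rightarrow> 'k) \<Rightarrow> 'e \<Rightarrow> 'e \<Rightarrow> 'k" where
  "corner_val z u v =
    (if \<exists>g n. is_corner u v g n
     then THE k. \<exists>g n. is_corner u v g n \<and> k = \<iota> g \<otimes>\<^bsub>K\<^esub> z n \<otimes>\<^bsub>K\<^esub> inv\<^bsub>K\<^esub> \<iota> g
     else \<one>\<^bsub>K\<^esub>)"

lemma corner_val_corner:
  assumes "is_corner u v g n"
  shows "corner_val z u v = \<iota> g \<otimes>\<^bsub>K\<^esub> z n \<otimes>\<^bsub>K\<^esub> inv\<^bsub>K\<^esub> \<iota> g"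
proof -
  have "(THE k. \<exists>g n. is_corner u v g n \<and> k = \<iota> g \<otimes>\<^bsub>K\<^esub> z n \<otimes>\<^bsub>K\<^esub> inv\<^bsub>K\<^esub> \<iota> g)
      = \<iota> g \<otimes>\<^bsub>K\<^esub> z n \<otimes>\<^bsub>K\<^esub> inv\<^bsub>K\<^esub> \<iota> g"
    using assms is_corner_unique by (intro the_equality) blast+
  then show ?thesis using assms by (auto simp: corner_val_def)
qed

lemma corner_val_no_corner: "\<nexists>g n. is_corner u v g n \<Longrightarrow> corner_val z u v = \<one>\<^bsub>K\<^esub>"
  by (metis corner_val_def)

lemma is_corner_act:
  assumes "g \<in> carrier G" "is_corner u v h n"
  shows "is_corner (act g u) (act g v) (g \<otimes> h) n"
  using assms base_edge by (auto simp: is_corner_def act_mult act_closed t_closed)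

lemma corner_val_closed [simp]:
  assumes "range z \<subseteq> carrier K" shows "corner_val z u v \<in> carrier K"
proof (cases "\<exists>g n. is_corner u v g n")
  case True
  then obtain g n where c: "is_corner u v g n" by blast
  then have "\<iota> g \<in> carrier K" by (simp add: is_corner_def)
  moreover have "z n \<in> carrier K" using assms by blast
  ultimately show ?thesis using corner_val_corner[OF c] by simp
qed (simp add: corner_val_no_corner)

lemma corner_val_act:
  assumes "range z \<subseteq> carrier K" "g \<in> carrier G" "u \<in> Edges" "v \<in> Edges"
  shows "corner_val z (act g u) (act g v) = \<iota> g \<otimes>\<^bsub>K\<^esub> corner_val z u v \<otimes>\<^bsub>K\<^esub> inv\<^bsub>K\<^esub> \<iota> g"
proof (cases "\<exists>h n. is_corner u v h n")
  case True
  then obtain h n where c: "is_corner u v h n" by blast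
  then have h: "h \<in> carrier G" by (simp add: is_corner_def)
  have "z n \<in> carrier K" using assms by blast
  then show ?thesis
    using corner_val_corner[OF c] corner_val_corner[OF is_corner_act[OF assms(2) c]] h assms(2)
    by (simp add: K.m_assoc K.inv_mult_group)
next
  case False
  have "\<not> is_corner (act g u) (act g v) h n" for h n
    using is_corner_act[of "inv g" "act g u" "act g v" h n] False assms
    by (auto simp: act_inv)
  then show ?thesis
    using False corner_val_no_corner[of u v] corner_val_no_corner[of "act g u" "act g v"] assms(2)
    by simp
qed

text \<open>Corners consist of two positive edges, so a pair of negative edges is a corner traversed backwards,
and no pair can be both.\<close>

fun turn :: "(nat \<Rightarrow> 'k) \<Rightarrow> 'e letter \<Rightarrow> 'e letter \<Rightarrow> 'k" where
  "turn z (Pos u) (Pos v) = corner_val z u v"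
| "turn z (Neg v) (Neg u) = inv\<^bsub>K\<^esub> corner_val z u v"
| "turn z _ _ = \<one>\<^bsub>K\<^esub>"

fun turn_indices :: "'e letter \<Rightarrow> 'e letter \<Rightarrow> nat set" where
  "turn_indices (Pos u) (Pos v) = {n. \<exists>g. is_corner u v g n}"
| "turn_indices (Neg v) (Neg u) = {n. \<exists>g. is_corner u v g n}"
| "turn_indices _ _ = {}"

lemma turn_closed [simp]: "range z \<subseteq> carrier K \<Longrightarrow> turn z l l' \<in> carrier K"
  by (cases l; cases l') auto

lemma turn_flip: "range z \<subseteq> carrier K \<Longrightarrow> turn z (flip l') (flip l) = inv\<^bsub>K\<^esub> turn z l l'"
  by (cases l; cases l') auto

lemma turn_act:
  assumes "range z \<subseteq> carrier K" "g \<in> carrier G" "set_letter l \<subseteq> Edges" "set_letter l' \<subseteq> Edges"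
  shows "turn z (map_letter (act g) l) (map_letter (act g) l')
    = \<iota> g \<otimes>\<^bsub>K\<^esub> turn z l l' \<otimes>\<^bsub>K\<^esub> inv\<^bsub>K\<^esub> \<iota> g"
  using assms
  by (cases l; cases l') (auto simp: corner_val_act K.inv_mult_group K.m_assoc)

lemma turn_indices_card: "finite (turn_indices l l') \<and> card (turn_indices l l') \<le> 1"
proof -
  have "m = n" if "m \<in> turn_indices l l'" "n \<in> turn_indices l l'" for m n
    using that is_corner_unique by (cases l; cases l') auto
  then have "turn_indices l l' = {n}" if "n \<in> turn_indices l l'" for n
    using that by blast
  then have "turn_indices l l' = {} \<or> (\<exists>n. turn_indices l l' = {n})"
    by blast
  then show ?thesis by auto
qed

lemma turn_in_subgroup:
  assumes "subgroup H K" "\<iota> ` carrier G \<subseteq> H" "\<And>n. n \<in> turn_indices l l' \<Longrightarrow> z n \<in> H"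
  shows "turn z l l' \<in> H"
proof -
  have "corner_val z u v \<in> H" if "\<And>n. \<exists>g. is_corner u v g n \<Longrightarrow> z n \<in> H" for u v
  proof (cases "\<exists>g n. is_corner u v g n")
    case True
    then obtain g n where c: "is_corner u v g n" by blast
    then have "\<iota> g \<in> H" "z n \<in> H"
      using assms(2) that by (auto simp: is_corner_def)
    then show ?thesis
      unfolding corner_val_corner[OF c]
      using subgroup.m_closed[OF assms(1)] subgroup.m_inv_closed[OF assms(1)] by blast
  qed (simp add: corner_val_no_corner subgroup.one_closed[OF assms(1)])
  then show ?thesis
    using assms(3) subgroup.m_inv_closed[OF assms(1)] subgroup.one_closed[OF assms(1)]
    by (cases l; cases l') auto
qed

lemma turn_trivial:
  assumes "\<And>n. n \<in> turn_indices l l' \<Longrightarrow> z n = \<one>\<^bsub>K\<^esub>"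
  shows "turn z l l' = \<one>\<^bsub>K\<^esub>"
proof -
  have "corner_val z u v = \<one>\<^bsub>K\<^esub>" if *: "\<And>n. \<exists>g. is_corner u v g n \<Longrightarrow> z n = \<one>\<^bsub>K\<^esub>" for u v
  proof (cases "\<exists>g n. is_corner u v g n")
    case True
    then obtain g n where c: "is_corner u v g n" by blast
    then have "\<iota> g \<in> carrier K" "z n = \<one>\<^bsub>K\<^esub>"
      using * by (auto simp: is_corner_def)
    then show ?thesis
      unfolding corner_val_corner[OF c] by simp
  qed (simp add: corner_val_no_corner)
  then show ?thesis using assms by (cases l; cases l') auto
qed

text \<open>Instead of cutting \<open>g\<close> at its corners and writing the inserted elements in between, all inserted elements are moved
to the left of \<open>g\<close>, where each becomes the conjugate by the element that leads to its corner. The product of these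
conjugates depends on the path only.\<close>

fun marks :: "(nat \<Rightarrow> 'k) \<Rightarrow> 'e gword \<Rightarrow> 'k" where
  "marks z (l # l' # xs) = turn z l l' \<otimes>\<^bsub>K\<^esub> marks z (l' # xs)"
| "marks z _ = \<one>\<^bsub>K\<^esub>"

fun corner_indices :: "'e gword \<Rightarrow> nat set" where
  "corner_indices (l # l' # xs) = turn_indices l l' \<union> corner_indices (l' # xs)"
| "corner_indices _ = {}"

definition junction_indices :: "'e gword \<Rightarrow> 'e gword \<Rightarrow> nat set" where
  "junction_indices xs ys = (if xs = [] \<or> ys = [] then {} else turn_indices (last xs) (hd ys))"

lemma junction_indices_card: "finite (junction_indices xs ys) \<and> card (junction_indices xs ys) \<le> 1"
  using turn_indices_card by (simp add: junction_indices_def)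

lemma marks_closed [simp]: "range z \<subseteq> carrier K \<Longrightarrow> marks z xs \<in> carrier K"
  by (induction z xs rule: marks.induct) auto

lemma marks_append_turn:
  assumes "range z \<subseteq> carrier K" "xs \<noteq> []" "ys \<noteq> []"
  shows "marks z (xs @ ys) = marks z xs \<otimes>\<^bsub>K\<^esub> turn z (last xs) (hd ys) \<otimes>\<^bsub>K\<^esub> marks z ys"
  using assms(2)
proof (induction xs rule: induct_list012)
  case (2 x)
  then show ?case using assms by (cases ys) auto
next
  case (3 x y zs)
  then show ?case using assms(1) by (simp add: K.m_assoc)
qed simp

lemma marks_append:
  assumes "range z \<subseteq> carrier K" "\<And>n. n \<in> junction_indices xs ys \<Longrightarrow> z n = \<one>\<^bsub>K\<^esub>"
  shows "marks z (xs @ ys) = marks z xs \<otimes>\<^bsub>K\<^esub> marks z ys"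
proof (cases "xs = [] \<or> ys = []")
  case False
  then have "turn z (last xs) (hd ys) = \<one>\<^bsub>K\<^esub>"
    using assms(2) by (intro turn_trivial) (auto simp: junction_indices_def)
  then show ?thesis using marks_append_turn[OF assms(1)] False assms(1) by simp
qed (use assms(1) in auto)

lemma marks_inv_word:
  assumes "range z \<subseteq> carrier K"
  shows "marks z (inv_word xs) = inv\<^bsub>K\<^esub> marks z xs"
proof (induction xs rule: induct_list012)
  case (3 x y zs)
  have "inv_word (x # y # zs) = inv_word (y # zs) @ [flip x]"
    "last (inv_word (y # zs)) = flip y" "inv_word (y # zs) \<noteq> []"
    by (auto simp: inv_word_def)
  then show ?case
    using 3 assms marks_append_turn[OF assms, of "inv_word (y # zs)" "[flip x]"]
    by (simp add: turn_flip K.inv_mult_group)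
qed (auto simp: inv_word_def)

lemma marks_translate:
  assumes "range z \<subseteq> carrier K" "g \<in> carrier G" "xs \<in> gwords Edges"
  shows "marks z (translate g xs) = \<iota> g \<otimes>\<^bsub>K\<^esub> marks z xs \<otimes>\<^bsub>K\<^esub> inv\<^bsub>K\<^esub> \<iota> g"
  using assms(3)
proof (induction xs rule: induct_list012)
  case (3 x y zs)
  have "marks z (translate g (x # y # zs)) =
    (\<iota> g \<otimes>\<^bsub>K\<^esub> turn z x y \<otimes>\<^bsub>K\<^esub> inv\<^bsub>K\<^esub> \<iota> g) \<otimes>\<^bsub>K\<^esub> (\<iota> g \<otimes>\<^bsub>K\<^esub> marks z (y # zs) \<otimes>\<^bsub>K\<^esub> inv\<^bsub>K\<^esub> \<iota> g)"
    using 3 turn_act[OF assms(1,2)] by (simp add: gwords_iff)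
  also have "\<dots> = \<iota> g \<otimes>\<^bsub>K\<^esub> (turn z x y \<otimes>\<^bsub>K\<^esub> marks z (y # zs)) \<otimes>\<^bsub>K\<^esub> inv\<^bsub>K\<^esub> \<iota> g"
    using assms(1,2) by (simp add: K.m_assoc K.inv_solve_left' flip: K.m_assoc[of "inv\<^bsub>K\<^esub> \<iota> g"])
  finally show ?case by simp
qed (use assms in auto)

lemma marks_in_subgroup:
  assumes "subgroup H K" "\<iota> ` carrier G \<subseteq> H" "\<And>n. n \<in> corner_indices xs \<Longrightarrow> z n \<in> H"
  shows "marks z xs \<in> H"
  using assms(3)
  by (induction xs rule: induct_list012)
    (auto intro: subgroup.m_closed[OF assms(1)] subgroup.one_closed[OF assms(1)]
      turn_in_subgroup[OF assms(1,2)])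

lemma marks_trivial:
  assumes "\<And>n. n \<in> corner_indices xs \<Longrightarrow> z n = \<one>\<^bsub>K\<^esub>"
  shows "marks z xs = \<one>\<^bsub>K\<^esub>"
  using assms by (induction xs rule: induct_list012) (auto simp: turn_trivial)

lemma finite_corner_indices: "finite (corner_indices xs)"
  by (induction xs rule: corner_indices.induct) (auto simp: turn_indices_card)

definition insertion :: "(nat \<Rightarrow> 'k) \<Rightarrow> 'g \<Rightarrow> 'k" where
  "insertion z g = marks z (path g) \<otimes>\<^bsub>K\<^esub> \<iota> g"

text \<open>If the path of \<open>g\<close> is \<open>p @ q\<close>, the translated path of \<open>h\<close> is \<open>inv_word q @ r\<close> and that of the product is \<open>p @ r\<close>, then the
marks along \<open>q\<close> cancel. The only corners that do not lie inside one of \<open>p\<close>, \<open>q\<close>, \<open>r\<close> are those at the three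
junctions. The set of their indices is found before \<open>z\<close> is chosen.\<close>

lemma insertion_mult:
  assumes "g \<in> carrier G" "h \<in> carrier G"
  shows "\<exists>B. finite B \<and> card B \<le> 3 \<and> (\<forall>z. range z \<subseteq> carrier K \<and> (\<forall>n\<in>B. z n = \<one>\<^bsub>K\<^esub>) \<longrightarrow>
    insertion z (g \<otimes> h) = insertion z g \<otimes>\<^bsub>K\<^esub> insertion z h)"
proof -
  obtain p q r where *: "path g = p @ q" "translate g (path h) = inv_word q @ r"
    "path (g \<otimes> h) = p @ r"
    using path_tripod[OF assms] .
  let ?B = "junction_indices p q \<union> junction_indices (inv_word q) r \<union> junction_indices p r"
  have "finite ?B" using junction_indices_card by simp
  moreover have "card ?B \<le> 3"
    using junction_indices_card[of p q] junction_indices_card[of "inv_word q" r]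
      junction_indices_card[of p r]
      card_Un_le[of "junction_indices p q \<union> junction_indices (inv_word q) r" "junction_indices p r"]
      card_Un_le[of "junction_indices p q" "junction_indices (inv_word q) r"]
    by linarith
  moreover have "insertion z (g \<otimes> h) = insertion z g \<otimes>\<^bsub>K\<^esub> insertion z h"
    if z: "range z \<subseteq> carrier K" and triv: "\<forall>n\<in>?B. z n = \<one>\<^bsub>K\<^esub>" for z
  proof -
    note [simp] = z assms
    have 1: "marks z (path g) = marks z p \<otimes>\<^bsub>K\<^esub> marks z q"
      unfolding *(1) using triv by (intro marks_append z) auto
    have 2: "\<iota> g \<otimes>\<^bsub>K\<^esub> marks z (path h) \<otimes>\<^bsub>K\<^esub> inv\<^bsub>K\<^esub> \<iota> g = inv\<^bsub>K\<^esub> marks z q \<otimes>\<^bsub>K\<^esub> marks z r"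
      unfolding marks_translate[OF z assms(1) path_edges[OF assms(2)], symmetric] *(2)
        marks_inv_word[OF z, symmetric]
      using triv by (intro marks_append z) auto
    have 3: "marks z (path (g \<otimes> h)) = marks z p \<otimes>\<^bsub>K\<^esub> marks z r"
      unfolding *(3) using triv by (intro marks_append z) auto
    have "insertion z g \<otimes>\<^bsub>K\<^esub> insertion z h
        = marks z (path g) \<otimes>\<^bsub>K\<^esub> (\<iota> g \<otimes>\<^bsub>K\<^esub> marks z (path h) \<otimes>\<^bsub>K\<^esub> inv\<^bsub>K\<^esub> \<iota> g) \<otimes>\<^bsub>K\<^esub> (\<iota> g \<otimes>\<^bsub>K\<^esub> \<iota> h)"
      by (simp add: insertion_def K.m_assoc flip: K.m_assoc[of "inv\<^bsub>K\<^esub> \<iota> g"])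
    also have "\<dots> = marks z p \<otimes>\<^bsub>K\<^esub> marks z r \<otimes>\<^bsub>K\<^esub> (\<iota> g \<otimes>\<^bsub>K\<^esub> \<iota> h)"
      unfolding 1 2 by (simp add: K.m_assoc flip: K.m_assoc[of "marks z q"])
    also have "\<dots> = insertion z (g \<otimes> h)"
      using 3 by (simp add: insertion_def)
    finally show ?thesis by simp
  qed
  ultimately show ?thesis by (intro exI[of _ ?B]) blast
qed

lemma insertion_one: "insertion z \<one> = \<one>\<^bsub>K\<^esub>"
  by (simp add: insertion_def path_one)

lemma insertion_inv:
  assumes "range z \<subseteq> carrier K" "g \<in> carrier G"
  shows "insertion z (inv g) = inv\<^bsub>K\<^esub> insertion z g"
  using assms path_edges[OF assms(2)]
  by (simp add: insertion_def path_inv marks_inv_word marks_translate K.inv_mult_group K.m_assoc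
      translate_gwords)

lemma insertion_in_subgroup:
  assumes "subgroup H K" "\<iota> ` carrier G \<subseteq> H" "g \<in> carrier G"
    "\<And>n. n \<in> corner_indices (path g) \<Longrightarrow> z n \<in> H"
  shows "insertion z g \<in> H"
  using marks_in_subgroup[of H "path g" z] assms subgroup.m_closed[OF assms(1)]
  by (auto simp: insertion_def)

lemma insertion_trivial:
  assumes "g \<in> carrier G" "\<And>n. n \<in> corner_indices (path g) \<Longrightarrow> z n = \<one>\<^bsub>K\<^esub>"
  shows "insertion z g = \<iota> g"
  using assms marks_trivial[of "path g" z] by (simp add: insertion_def)

end

section \<open>Multiplicativity outside few indices\<close>

context corner_family
begin

lemma insertion_letter_val:
  assumes "range z \<subseteq> carrier K" "f ` V \<subseteq> carrier G" "set_letter l \<subseteq> V"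
  shows "insertion z (letter_val G f l) = letter_val K (insertion z \<circ> f) l"
  using assms by (cases l) (auto simp: insertion_inv)

text \<open>One multiplication for each letter of the word, with three bad indices each.\<close>

lemma insertion_word_val:
  assumes "f ` V \<subseteq> carrier G" "w \<in> gwords V"
  shows "\<exists>B. finite B \<and> card B \<le> 3 * length w \<and>
    (\<forall>z. range z \<subseteq> carrier K \<and> (\<forall>n\<in>B. z n = \<one>\<^bsub>K\<^esub>) \<longrightarrow>
      insertion z (word_val G f w) = word_val K (insertion z \<circ> f) w)"
  using assms(2)
proof (induction w)
  case Nil
  then show ?case by (intro exI[of _ "{}"]) (simp add: insertion_one)
next
  case (Cons l w)
  then have w: "w \<in> gwords V" and l: "set_letter l \<subseteq> V"
    by (auto simp: gwords_iff)
  obtain B where B: "finite B" "card B \<le> 3 * length w"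
    "\<And>z. range z \<subseteq> carrier K \<Longrightarrow> \<forall>n\<in>B. z n = \<one>\<^bsub>K\<^esub> \<Longrightarrow>
      insertion z (word_val G f w) = word_val K (insertion z \<circ> f) w"
    using Cons.IH[OF w] by blast
  obtain B' where B': "finite B'" "card B' \<le> 3"
    "\<And>z. range z \<subseteq> carrier K \<Longrightarrow> \<forall>n\<in>B'. z n = \<one>\<^bsub>K\<^esub> \<Longrightarrow>
      insertion z (letter_val G f l \<otimes> word_val G f w)
        = insertion z (letter_val G f l) \<otimes>\<^bsub>K\<^esub> insertion z (word_val G f w)"
    using insertion_mult[OF letter_val_closed[OF assms(1) l] word_val_closed[OF assms(1) w]] by blast
  have "card (B \<union> B') \<le> 3 * length (l # w)"
    using card_Un_le[of B B'] B(2) B'(2) by simp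
  then show ?case
    using B(1,3) B'(1,3) insertion_letter_val[OF _ assms(1) l]
    by (intro exI[of _ "B \<union> B'"]) (simp add: comp_def)
qed

text \<open>The path of a product of the elements \<open>t m\<close> has no cancellation, as all its edges are positive. The final
factor \<open>t 0\<close> contributes the edge that completes the corner of the last index; its own index does not appear.\<close>

fun corner_word :: "nat list \<Rightarrow> 'g" where
  "corner_word [] = t 0"
| "corner_word (m # ms) = t m \<otimes> corner_word ms"

lemma corner_word_closed [simp]: "corner_word ms \<in> carrier G"
  by (induction ms) (auto simp: t_closed)

lemma path_corner_word_Cons:
  "path (corner_word (m # ms)) = Pos e # translate (t m) (path (corner_word ms))
    \<and> (\<exists>xs. path (corner_word ms) = Pos e # xs)"
proof (induction ms arbitrary: m)
  case Nil
  then show ?case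
    using path_mult[OF t_closed t_closed, of m 0] by (simp add: path_t free_cons_def)
next
  case (Cons n ms)
  then obtain xs where "path (corner_word (n # ms)) = Pos e # xs"
    by blast
  then show ?case
    using path_mult[OF t_closed corner_word_closed, of m "n # ms"]
    by (simp add: path_t free_cons_def)
qed

lemma is_corner_base: "is_corner e (act (t m) e) \<one> m"
  using base_edge t_closed by (auto simp: is_corner_def act_one act_closed)

lemma insertion_corner_word_Cons:
  assumes "range z \<subseteq> carrier K"
  shows "insertion z (corner_word (m # ms)) = z m \<otimes>\<^bsub>K\<^esub> \<iota> (t m) \<otimes>\<^bsub>K\<^esub> insertion z (corner_word ms)"
proof -
  obtain xs where xs: "path (corner_word ms) = Pos e # xs"
    using path_corner_word_Cons by blast
  have zm: "z m \<in> carrier K" using assms by blast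
  have "marks z (path (corner_word (m # ms)))
      = z m \<otimes>\<^bsub>K\<^esub> marks z (translate (t m) (path (corner_word ms)))"
    using path_corner_word_Cons[of m ms] xs corner_val_corner[OF is_corner_base] zm by simp
  also have "\<dots> = z m \<otimes>\<^bsub>K\<^esub>
      (\<iota> (t m) \<otimes>\<^bsub>K\<^esub> marks z (path (corner_word ms)) \<otimes>\<^bsub>K\<^esub> inv\<^bsub>K\<^esub> \<iota> (t m))"
    using marks_translate[OF assms t_closed path_edges] by simp
  finally show ?thesis
    using zm assms t_closed
    by (simp add: insertion_def K.m_assoc flip: K.m_assoc[of "inv\<^bsub>K\<^esub> \<iota> (t m)"])
qed

lemma turn_indices_base: "turn_indices (Pos e) (Pos (act (t m) e)) = {m}"
  using is_corner_base[of m] is_corner_unique[OF _ is_corner_base[of m]] by auto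

lemma turn_indices_translate:
  assumes "g \<in> carrier G" "n \<in> turn_indices l l'"
  shows "n \<in> turn_indices (map_letter (act g) l) (map_letter (act g) l')"
proof -
  have "\<exists>h. is_corner (act g u) (act g v) h n" if "\<exists>h. is_corner u v h n" for u v
    using that is_corner_act[OF assms(1)] by blast
  then show ?thesis using assms(2) by (cases l; cases l') auto
qed

lemma corner_indices_translate:
  assumes "g \<in> carrier G"
  shows "corner_indices xs \<subseteq> corner_indices (translate g xs)"
  by (induction xs rule: induct_list012) (auto intro: turn_indices_translate[OF assms])

lemma corner_indices_corner_word: "set ms \<subseteq> corner_indices (path (corner_word ms))"
proof (induction ms)
  case (Cons m ms)
  obtain xs where xs: "path (corner_word ms) = Pos e # xs"
    using path_corner_word_Cons by blast
  have "set ms \<subseteq> corner_indices (translate (t m) (path (corner_word ms)))"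
    using Cons corner_indices_translate[OF t_closed] by blast
  then show ?case
    using path_corner_word_Cons[of m ms] xs turn_indices_base[of m] by auto
qed simp

lemma insertion_corner_word_trivial:
  assumes "range z \<subseteq> carrier K" "\<And>m. m \<in> set ms \<Longrightarrow> z m = \<one>\<^bsub>K\<^esub>"
  shows "insertion z (corner_word ms) = \<iota> (corner_word ms)"
  using assms(2)
proof (induction ms)
  case Nil
  then show ?case by (simp add: insertion_def path_t t_closed)
next
  case (Cons m ms)
  then show ?case
    using insertion_corner_word_Cons[OF assms(1), of m ms] by (simp add: t_closed)
qed

text \<open>The elements \<open>g\<close> and \<open>h\<close> do not depend on \<open>z\<close>, so that the equation for the value of
\<open>insertion z\<close> can later be solved for \<open>z n\<close>.\<close>

lemma insertion_corner_word:
  assumes "n \<in> set ms" "distinct ms"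
  shows "\<exists>g\<in>carrier G. \<exists>h\<in>carrier G. \<forall>z. range z \<subseteq> carrier K \<and> (\<forall>m\<in>set ms - {n}. z m = \<one>\<^bsub>K\<^esub>) \<longrightarrow>
    insertion z (corner_word ms) = \<iota> g \<otimes>\<^bsub>K\<^esub> z n \<otimes>\<^bsub>K\<^esub> \<iota> h"
  using assms
proof (induction ms)
  case (Cons m ms)
  show ?case
  proof (cases "m = n")
    case True
    have "insertion z (corner_word (m # ms)) = \<iota> \<one> \<otimes>\<^bsub>K\<^esub> z n \<otimes>\<^bsub>K\<^esub> \<iota> (corner_word (m # ms))"
      if z: "range z \<subseteq> carrier K" "\<forall>l\<in>set (m # ms) - {n}. z l = \<one>\<^bsub>K\<^esub>" for z
    proof -
      have "insertion z (corner_word ms) = \<iota> (corner_word ms)"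
        using z Cons.prems(2) True by (intro insertion_corner_word_trivial) auto
      moreover have "z n \<in> carrier K" using z(1) by blast
      ultimately show ?thesis
        using True insertion_corner_word_Cons[OF z(1), of m ms] by (simp add: t_closed K.m_assoc)
    qed
    then show ?thesis
      using one_closed corner_word_closed[of "m # ms"] by blast
  next
    case False
    then obtain g h where gh: "g \<in> carrier G" "h \<in> carrier G"
      "\<And>z. range z \<subseteq> carrier K \<Longrightarrow> \<forall>m\<in>set ms - {n}. z m = \<one>\<^bsub>K\<^esub> \<Longrightarrow>
        insertion z (corner_word ms) = \<iota> g \<otimes>\<^bsub>K\<^esub> z n \<otimes>\<^bsub>K\<^esub> \<iota> h"
      using Cons.IH Cons.prems by auto
    have "insertion z (corner_word (m # ms)) = \<iota> (t m \<otimes> g) \<otimes>\<^bsub>K\<^esub> z n \<otimes>\<^bsub>K\<^esub> \<iota> h"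
      if z: "range z \<subseteq> carrier K" "\<forall>l\<in>set (m # ms) - {n}. z l = \<one>\<^bsub>K\<^esub>" for z
    proof -
      have "insertion z (corner_word ms) = \<iota> g \<otimes>\<^bsub>K\<^esub> z n \<otimes>\<^bsub>K\<^esub> \<iota> h" "z m = \<one>\<^bsub>K\<^esub>"
        using gh(3)[of z] z False by auto
      moreover have "z n \<in> carrier K" using z(1) by blast
      ultimately show ?thesis
        using insertion_corner_word_Cons[OF z(1), of m ms] gh(1,2) by (simp add: t_closed K.m_assoc)
    qed
    moreover have "t m \<otimes> g \<in> carrier G" using gh(1) t_closed by simp
    ultimately show ?thesis using gh(2) by blast
  qed
qed simp

end

section \<open>Playing the quantifier prefix\<close>

text \<open>The universal player may follow any strategy that looks at the history of the play.\<close>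

lemma forall_exists_play:
  assumes "forall_exists D k \<Phi>"
    and "\<And>xs ys. set xs \<subseteq> D \<Longrightarrow> set ys \<subseteq> D \<Longrightarrow> strat xs ys \<in> D"
  shows "\<exists>xs ys. length xs = k \<and> length ys = k \<and> set xs \<subseteq> D \<and> set ys \<subseteq> D \<and> \<Phi> xs ys \<and>
    (\<forall>i<k. xs ! i = strat (take i xs) (take i ys))"
  using assms
proof (induction k arbitrary: \<Phi> strat)
  case (Suc k)
  define x where "x = strat [] []"
  have x: "x \<in> D" using Suc.prems(2) by (simp add: x_def)
  then obtain y where y: "y \<in> D" "forall_exists D k (\<lambda>xs ys. \<Phi> (x # xs) (y # ys))"
    using Suc.prems(1) by auto
  obtain xs ys where *: "length xs = k" "length ys = k" "set xs \<subseteq> D" "set ys \<subseteq> D"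
    "\<Phi> (x # xs) (y # ys)" "\<And>i. i < k \<Longrightarrow> xs ! i = strat (x # take i xs) (y # take i ys)"
    using Suc.IH[OF y(2), of "\<lambda>xs ys. strat (x # xs) (y # ys)"] Suc.prems(2) x y(1) by fastforce
  have "(x # xs) ! i = strat (take i (x # xs)) (take i (y # ys))" if "i < Suc k" for i
    using that *(6) by (cases i) (auto simp: x_def)
  then show ?case
    using * x y(1) by (intro exI[of _ "x # xs"] exI[of _ "y # ys"]) simp
qed simp

context corner_family
begin

definition seen :: "'g set \<Rightarrow> nat set" where
  "seen M = (\<Union>g\<in>M. corner_indices (path g))"

lemma finite_seen: "finite M \<Longrightarrow> finite (seen M)"
  by (simp add: seen_def finite_corner_indices)

definition fresh :: "nat \<Rightarrow> nat set \<Rightarrow> nat list" where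
  "fresh N M = [Suc (Max (insert 0 M))..<Suc (Max (insert 0 M)) + N]"

lemma fresh: "finite M \<Longrightarrow> set (fresh N M) \<inter> M = {}" "distinct (fresh N M)" "length (fresh N M) = N"
proof -
  assume "finite M"
  then have "m \<le> Max (insert 0 M)" if "m \<in> M" for m
    using that by (intro Max_ge) auto
  then show "set (fresh N M) \<inter> M = {}"
    by (fastforce simp: fresh_def)
qed (auto simp: fresh_def)

text \<open>The universal player uses \<open>3 |S| + 1\<close> fresh corners in each move, so that one of them survives the
at most \<open>3 |S|\<close> bad indices, whatever the answers are.\<close>

theorem formal_solution:
  assumes A: "finite A" "c ` A \<subseteq> carrier G" and S: "S \<in> gwords (eqn_symbols k A)"
    and x: "\<And>i. i < k \<Longrightarrow> x i \<in> carrier K"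
    and sol: "forall_exists (carrier G) k (\<lambda>xs ys. word_val G (assign c xs ys) S = \<one>)"
  shows "\<exists>q. length q = k \<and>
    (\<forall>i<k. q ! i \<in> generate K (\<iota> ` carrier G \<union> x ` {..i})) \<and>
    word_val K (assign (\<iota> \<circ> c) (map x [0..<k]) q) S = \<one>\<^bsub>K\<^esub>"
proof -
  define N where "N = Suc (3 * length S)"
  define I where "I = (\<lambda>xs ys. fresh N (seen (c ` A \<union> set xs \<union> set ys)))"
  obtain xs ys where len: "length xs = k" "length ys = k"
    and xs: "set xs \<subseteq> carrier G" and ys: "set ys \<subseteq> carrier G"
    and solved: "word_val G (assign c xs ys) S = \<one>"
    and xs_nth: "\<And>i. i < k \<Longrightarrow> xs ! i = corner_word (I (take i xs) (take i ys))"
    using forall_exists_play[OF sol, of "\<lambda>xs ys. corner_word (I xs ys)"] by auto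
  define J where "J i = I (take i xs) (take i ys)" for i
  have assign_closed: "assign c xs ys ` eqn_symbols k A \<subseteq> carrier G"
    using A(2) xs ys len by (auto simp: eqn_symbols_def subset_iff)
  obtain B where B: "finite B" "card B \<le> 3 * length S"
    "\<And>z. range z \<subseteq> carrier K \<Longrightarrow> \<forall>n\<in>B. z n = \<one>\<^bsub>K\<^esub> \<Longrightarrow>
      insertion z (word_val G (assign c xs ys) S) = word_val K (insertion z \<circ> assign c xs ys) S"
    using insertion_word_val[OF assign_closed S] by blast
  have J: "distinct (J i)" "length (J i) = N"
    "set (J i) \<inter> seen (c ` A \<union> set (take i xs) \<union> set (take i ys)) = {}" for i
    unfolding J_def I_def using A(1) by (intro fresh finite_seen; simp)+
  have "\<exists>n. n \<in> set (J i) \<and> n \<notin> B" for i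
  proof (rule ccontr)
    assume "\<not> ?thesis"
    then have "card (set (J i)) \<le> card B" using B(1) by (intro card_mono) auto
    then show False using B(2) J(1,2)[of i] by (simp add: distinct_card N_def)
  qed
  then obtain n where n: "\<And>i. n i \<in> set (J i)" "\<And>i. n i \<notin> B" by metis
  have n_seen: "n i \<notin> seen (c ` A \<union> set (take i xs) \<union> set (take i ys))" for i
    using n(1) J(3) by blast
  have J_seen: "set (J i) \<subseteq> corner_indices (path (xs ! i))" if "i < k" for i
    using corner_indices_corner_word[of "J i"] xs_nth[OF that] by (simp add: J_def)
  \<comment> \<open>Indices of a later move are fresh for the earlier values, so they occur in none of them.\<close>
  have seen_later: "n j \<notin> corner_indices (path (xs ! i))" "n j \<notin> corner_indices (path (ys ! i))"
    if "i < j" "j < k" for i j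
  proof -
    have "xs ! i \<in> set (take j xs)" "ys ! i \<in> set (take j ys)"
      using that len by (auto simp: in_set_conv_nth intro!: exI[of _ i])
    then show "n j \<notin> corner_indices (path (xs ! i))" "n j \<notin> corner_indices (path (ys ! i))"
      using n_seen[of j] by (auto simp: seen_def)
  qed
  have n_other: "n j \<notin> set (J i)" if "i < k" "j < k" "i \<noteq> j" for i j
  proof (cases "i < j")
    case True
    then show ?thesis using seen_later(1) J_seen that by blast
  next
    case False
    then have "xs ! j \<in> set (take i xs)"
      using that len by (auto simp: in_set_conv_nth intro!: exI[of _ j])
    moreover have "n j \<in> corner_indices (path (xs ! j))"
      using J_seen[of j] n(1)[of j] that by blast
    ultimately show ?thesis using J(3)[of i] by (auto simp: seen_def)
  qed
  then have n_inj: "i = j" if "n i = n j" "i < k" "j < k" for i j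
    using that n(1) by metis
  have "\<exists>g h. g \<in> carrier G \<and> h \<in> carrier G \<and>
      (\<forall>z. range z \<subseteq> carrier K \<and> (\<forall>m\<in>set (J i) - {n i}. z m = \<one>\<^bsub>K\<^esub>) \<longrightarrow>
        insertion z (corner_word (J i)) = \<iota> g \<otimes>\<^bsub>K\<^esub> z (n i) \<otimes>\<^bsub>K\<^esub> \<iota> h)" for i
    using insertion_corner_word[OF n(1) J(1), of i] by blast
  then obtain g h where gh: "\<And>i. g i \<in> carrier G" "\<And>i. h i \<in> carrier G"
    "\<And>i z. range z \<subseteq> carrier K \<Longrightarrow> \<forall>m\<in>set (J i) - {n i}. z m = \<one>\<^bsub>K\<^esub> \<Longrightarrow>
        insertion z (corner_word (J i)) = \<iota> (g i) \<otimes>\<^bsub>K\<^esub> z (n i) \<otimes>\<^bsub>K\<^esub> \<iota> (h i)"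
    by metis
  \<comment> \<open>The solution of \<open>\<iota> (g i) \<zeta> \<iota> (h i) = x i\<close>.\<close>
  define \<zeta> where "\<zeta> i = inv\<^bsub>K\<^esub> \<iota> (g i) \<otimes>\<^bsub>K\<^esub> x i \<otimes>\<^bsub>K\<^esub> inv\<^bsub>K\<^esub> \<iota> (h i)" for i
  define z where "z m = (if \<exists>i<k. m = n i then \<zeta> (THE i. i < k \<and> m = n i) else \<one>\<^bsub>K\<^esub>)" for m
  have z_n: "z (n i) = \<zeta> i" if "i < k" for i
  proof -
    have "(THE j. j < k \<and> n i = n j) = i"
      using that n_inj by (intro the_equality) auto
    then show ?thesis using that by (auto simp: z_def)
  qed
  have z_1: "z m = \<one>\<^bsub>K\<^esub>" if "\<And>i. i < k \<Longrightarrow> m \<noteq> n i" for m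
    using that by (auto simp: z_def)
  have \<zeta>: "\<zeta> i \<in> carrier K" if "i < k" for i
    using x[OF that] gh(1,2) by (simp add: \<zeta>_def)
  have z: "range z \<subseteq> carrier K"
    using z_n z_1 \<zeta> by (metis K.one_closed image_subsetI)
  have ins_x: "insertion z (xs ! i) = x i" if "i < k" for i
  proof -
    have "z m = \<one>\<^bsub>K\<^esub>" if "m \<in> set (J i) - {n i}" for m
      using that \<open>i < k\<close> n_other by (intro z_1) blast
    then have "insertion z (xs ! i) = \<iota> (g i) \<otimes>\<^bsub>K\<^esub> \<zeta> i \<otimes>\<^bsub>K\<^esub> \<iota> (h i)"
      using gh(3)[OF z] z_n[OF that] xs_nth[OF that] by (simp add: J_def)
    then show ?thesis
      using x[OF that] gh(1,2)[of i]
      by (simp add: \<zeta>_def K.m_assoc flip: K.m_assoc[of "\<iota> (g i)" "inv\<^bsub>K\<^esub> \<iota> (g i)"])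
  qed
  have ins_c: "insertion z (c a) = \<iota> (c a)" if "a \<in> A" for a
  proof (rule insertion_trivial)
    show "z m = \<one>\<^bsub>K\<^esub>" if "m \<in> corner_indices (path (c a))" for m
    proof (rule z_1)
      show "m \<noteq> n i" for i
        using n_seen[of i] that \<open>a \<in> A\<close> by (auto simp: seen_def)
    qed
  qed (use A(2) that in auto)
  have q_gen: "insertion z (ys ! i) \<in> generate K (\<iota> ` carrier G \<union> x ` {..i})" if "i < k" for i
  proof -
    let ?H = "generate K (\<iota> ` carrier G \<union> x ` {..i})"
    have sub: "subgroup ?H K"
      using x that by (intro K.generate_is_subgroup) auto
    have gen: "y \<in> \<iota> ` carrier G \<union> x ` {..i} \<Longrightarrow> y \<in> ?H" for y
      by (rule generate.incl)
    show ?thesis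
    proof (rule insertion_in_subgroup[OF sub])
      show "\<iota> ` carrier G \<subseteq> ?H" using gen by blast
      show "ys ! i \<in> carrier G" using ys len that by auto
      show "z m \<in> ?H" if m: "m \<in> corner_indices (path (ys ! i))" for m
      proof (cases "\<exists>j<k. m = n j")
        case True
        then obtain j where j: "j < k" "m = n j" by blast
        then have "j \<le> i"
          using seen_later(2)[of i j] m by (meson not_less)
        then have "x j \<in> ?H" "\<iota> (g j) \<in> ?H" "\<iota> (h j) \<in> ?H"
          using gh(1,2) by (auto intro!: gen)
        then have "\<zeta> j \<in> ?H"
          unfolding \<zeta>_def
          by (intro subgroup.m_closed[OF sub] subgroup.m_inv_closed[OF sub])
        then show ?thesis using z_n j by simp
      next
        case False
        then show ?thesis using z_1[of m] subgroup.one_closed[OF sub] by metis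
      qed
    qed
  qed
  have "\<one>\<^bsub>K\<^esub> = insertion z (word_val G (assign c xs ys) S)"
    by (simp add: solved insertion_one)
  also have "\<dots> = word_val K (insertion z \<circ> assign c xs ys) S"
  proof (rule B(3)[OF z], safe)
    show "z m = \<one>\<^bsub>K\<^esub>" if "m \<in> B" for m
      using n(2) that by (intro z_1) blast
  qed
  also have "\<dots> = word_val K (assign (\<iota> \<circ> c) (map x [0..<k]) (map (insertion z) ys)) S"
    using S
  proof (rule word_val_cong)
    fix v assume "v \<in> eqn_symbols k A"
    then show "(insertion z \<circ> assign c xs ys) v
        = assign (\<iota> \<circ> c) (map x [0..<k]) (map (insertion z) ys) v"
      using ins_x ins_c len by (auto simp: eqn_symbols_def)
  qed
  finally show ?thesis
    using q_gen len by (intro exI[of _ "map (insertion z) ys"]) simp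
qed

end

section \<open>Homomorphisms from presented groups\<close>

definition word_class :: "'a set \<Rightarrow> 'a gword set \<Rightarrow> 'a gword \<Rightarrow> 'a gword set" where
  "word_class A R w = pres_rel A R `` {w}"

lemma word_class_mult:
  "u \<in> gwords A \<Longrightarrow> v \<in> gwords A \<Longrightarrow>
    word_class A R u \<otimes>\<^bsub>presented_group A R\<^esub> word_class A R v = word_class A R (u @ v)"
  by (simp add: word_class_def pres_class_mult)

lemma word_class_closed: "w \<in> gwords A \<Longrightarrow> word_class A R w \<in> carrier (presented_group A R)"
  by (simp add: word_class_def presented_group_def quotientI)

lemma word_class_Nil: "word_class A R [] = \<one>\<^bsub>presented_group A R\<^esub>"
  by (simp add: word_class_def presented_group_def)

lemma word_class_eq: "pres_eq A R u v \<Longrightarrow> word_class A R u = word_class A R v"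
  unfolding word_class_def by (rule equiv_class_eq[OF equiv_pres_rel]) (simp add: pres_rel_def)

lemma word_class_eqD: "word_class A R u = word_class A R v \<Longrightarrow> v \<in> gwords A \<Longrightarrow> pres_eq A R u v"
  using eq_equiv_class[OF _ equiv_pres_rel] by (fastforce simp: word_class_def pres_rel_def)

lemma pres_gen_eq: "pres_gen A R a = word_class A R [Pos a]"
  by (simp add: pres_gen_def word_class_def)

lemma pres_gen_closed: "a \<in> A \<Longrightarrow> pres_gen A R a \<in> carrier (presented_group A R)"
  by (simp add: pres_gen_eq word_class_closed gwords_iff)

text \<open>A word represents its own class: this links evaluation in the presented group with the congruence on words.\<close>

lemma word_val_pres_gen:
  assumes "w \<in> gwords A"
  shows "word_val (presented_group A R) (pres_gen A R) w = word_class A R w"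
  using assms
proof (induction w)
  case (Cons l w)
  interpret group "presented_group A R" by (rule group_presented_group)
  have w: "w \<in> gwords A" and l: "set_letter l \<subseteq> A" using Cons.prems by (auto simp: gwords_iff)
  have "letter_val (presented_group A R) (pres_gen A R) l = word_class A R [l]"
  proof (cases l)
    case (Neg a)
    have "pres_eq A R [Neg a, Pos a] []"
      using pres_eq.cancel[of "Neg a" A R] l Neg by (simp add: gwords_iff)
    then have "word_class A R [Neg a] \<otimes>\<^bsub>presented_group A R\<^esub> pres_gen A R a = \<one>\<^bsub>presented_group A R\<^esub>"
      using l Neg by (simp add: pres_gen_eq word_class_mult gwords_iff word_class_eq flip: word_class_Nil)
    then show ?thesis
      using inv_equality[of "word_class A R [Neg a]" "pres_gen A R a"] l Neg
      by (simp add: pres_gen_closed word_class_closed gwords_iff)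
  qed (simp add: pres_gen_eq)
  then show ?case
    using Cons.IH[OF w] w l by (simp add: word_class_mult gwords_iff)
qed (simp add: word_class_Nil)

lemma presented_group_cases:
  assumes "g \<in> carrier (presented_group A R)"
  obtains w where "w \<in> gwords A" "g = word_class A R w"
  using assms by (auto simp: presented_group_def word_class_def elim: quotientE)

lemma word_val_pres_eq:
  assumes "group K" "f ` A \<subseteq> carrier K" "\<And>r. r \<in> R \<Longrightarrow> r \<in> gwords A \<Longrightarrow> word_val K f r = \<one>\<^bsub>K\<^esub>"
    and "pres_eq A R u v"
  shows "word_val K f u = word_val K f v"
proof -
  interpret group K by fact
  show ?thesis
    using assms(4)
  proof (induction rule: pres_eq.induct)
    case (cong u v p s)
    then show ?case
      using pres_eq_gwords[OF cong.hyps(1)] by (simp add: word_val_append[OF assms(2)])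
  next
    case (cancel l)
    then show ?case
      using assms(2) by (cases l) (auto simp: gwords_iff image_subset_iff)
  qed (use assms(3) in auto)
qed

lemma presented_group_hom:
  assumes "group K" "f ` A \<subseteq> carrier K" "\<And>r. r \<in> R \<Longrightarrow> r \<in> gwords A \<Longrightarrow> word_val K f r = \<one>\<^bsub>K\<^esub>"
  obtains \<phi> where "\<phi> \<in> hom (presented_group A R) K" "\<And>a. a \<in> A \<Longrightarrow> \<phi> (pres_gen A R a) = f a"
proof -
  interpret group K by fact
  define \<phi> where "\<phi> g = word_val K f (SOME w. w \<in> gwords A \<and> g = word_class A R w)" for g
  have \<phi>: "\<phi> (word_class A R w) = word_val K f w" if "w \<in> gwords A" for w
  proof -
    have "\<exists>v. v \<in> gwords A \<and> word_class A R w = word_class A R v"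
      using that by blast
    from someI_ex[OF this]
    have "pres_eq A R w (SOME v. v \<in> gwords A \<and> word_class A R w = word_class A R v)"
      by (intro word_class_eqD) auto
    then show ?thesis
      unfolding \<phi>_def using word_val_pres_eq[OF assms] by simp
  qed
  show thesis
  proof (rule that)
    show "\<phi> \<in> hom (presented_group A R) K"
      using \<phi> by (intro homI; elim presented_group_cases)
        (auto simp: word_class_mult word_val_append[OF assms(2)] word_val_closed[OF assms(2)])
    show "\<phi> (pres_gen A R a) = f a" if "a \<in> A" for a
      using \<phi>[of "[Pos a]"] assms(2) that by (auto simp: pres_gen_eq gwords_iff)
  qed
qed

text \<open>The multiplication table of \<open>G\<close> is among the relators.\<close>

lemma fp_inl_hom:
  assumes "group G" shows "fp_inl G H \<in> hom G (free_product G H)"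
proof -
  let ?A = "carrier G <+> carrier H" and ?R = "fp_rels G H"
  interpret G: group G by fact
  interpret P: group "free_product G H"
    unfolding free_product_def by (rule group_presented_group)
  have closed: "fp_inl G H a \<in> carrier (free_product G H)" if "a \<in> carrier G" for a
    unfolding free_product_def fp_inl_def using that by (intro pres_gen_closed) auto
  show ?thesis
  proof (rule homI)
    fix a b assume ab: "a \<in> carrier G" "b \<in> carrier G"
    let ?r = "[Pos (Inl a), Pos (Inl b), Neg (Inl (a \<otimes>\<^bsub>G\<^esub> b))]"
    have A: "?r \<in> gwords ?A" using ab by (auto simp: gwords_iff)
    have "?r \<in> ?R" using ab by (auto simp: fp_rels_def)
    then have "word_class ?A ?R ?r = word_class ?A ?R []"
      using A by (intro word_class_eq pres_eq.rel)
    then have "word_val (free_product G H) (pres_gen ?A ?R) ?r = \<one>\<^bsub>free_product G H\<^esub>"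
      unfolding free_product_def using word_val_pres_gen[OF A] word_class_Nil by metis
    then have "fp_inl G H a \<otimes>\<^bsub>free_product G H\<^esub> fp_inl G H b
        \<otimes>\<^bsub>free_product G H\<^esub> inv\<^bsub>free_product G H\<^esub> fp_inl G H (a \<otimes>\<^bsub>G\<^esub> b) = \<one>\<^bsub>free_product G H\<^esub>"
      using closed ab by (simp add: fp_inl_def P.m_assoc)
    then show "fp_inl G H (a \<otimes>\<^bsub>G\<^esub> b) = fp_inl G H a \<otimes>\<^bsub>free_product G H\<^esub> fp_inl G H b"
      using closed ab P.inv_equality
      by (metis G.m_closed P.inv_closed P.inv_inv P.m_closed)
  qed (rule closed)
qed

lemma (in group) generate_commute:
  assumes "S \<subseteq> carrier G" "T \<subseteq> carrier G" "\<And>s t. s \<in> S \<Longrightarrow> t \<in> T \<Longrightarrow> s \<otimes> t = t \<otimes> s"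
    and "x \<in> generate G S" "y \<in> generate G T"
  shows "x \<otimes> y = y \<otimes> x"
proof -
  have centre: "x \<otimes> t = t \<otimes> x"
    if "t \<in> carrier G" "S \<subseteq> carrier G" "\<And>s. s \<in> S \<Longrightarrow> s \<otimes> t = t \<otimes> s" "x \<in> generate G S" for S x t
    using that(4)
  proof (induction rule: generate.induct)
    case (inv s)
    then have s: "s \<in> carrier G" "s \<otimes> t = t \<otimes> s" using that by auto
    have "s \<otimes> (t \<otimes> inv s) = t \<otimes> s \<otimes> inv s"
      using s that(1) by (simp flip: m_assoc)
    also have "\<dots> = t"
      using s(1) that(1) by (simp add: m_assoc)
    finally show ?case
      using s(1) that(1) by (simp add: inv_solve_left')
  next
    case (eng g h)
    then have "g \<in> carrier G" "h \<in> carrier G" using generate_in_carrier[OF that(2)] by auto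
    then show ?case using eng that(1) by (metis m_assoc)
  qed (use that in auto)
  have "t \<otimes> x = x \<otimes> t" if "t \<in> T" for t
    using centre[of t S x] assms(1,2,4) assms(3)[OF _ that] that by auto
  then have "y \<otimes> x = x \<otimes> y"
    using centre[of x T y] generate_in_carrier[OF assms(1,4)] assms(2,5) by simp
  then show ?thesis by simp
qed

section \<open>Paths in a partially commutative group\<close>

locale partially_commutative =
  fixes A :: "'a set" and E :: "'a set set" and G :: "'a gword set monoid" (structure)
  assumes graph: "finite_simple_graph A E" and G_eq: "G = pc_group A E"
begin

sublocale group G
  unfolding G_eq pc_group_def by (rule group_presented_group)

abbreviation gen :: "'a \<Rightarrow> 'a gword set" where
  "gen \<equiv> pc_gen A E"

abbreviation elem :: "'a gword \<Rightarrow> 'a gword set" where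
  "elem \<equiv> word_class A (commutator_rels E)"

definition link :: "'a \<Rightarrow> 'a set" where
  "link c = {d. {c, d} \<in> E}"

text \<open>The subgroup that is associated with itself by the stable letter \<open>c\<close> when \<open>G\<close> is seen as an HNN
extension. Its cosets are the edges of the Bass--Serre tree for \<open>c\<close>.\<close>

definition edge_group :: "'a \<Rightarrow> 'a gword set set" where
  "edge_group c = generate G (gen ` link c)"

lemma E_D: "{c, d} \<in> E \<Longrightarrow> c \<in> A \<and> d \<in> A \<and> c \<noteq> d"
  using graph by (fastforce simp: finite_simple_graph_def)

lemma link_subset: "link c \<subseteq> A - {c}"
  using E_D by (auto simp: link_def)

lemma gen_closed [simp]: "c \<in> A \<Longrightarrow> gen c \<in> carrier G"
  unfolding G_eq pc_group_def pc_gen_def by (rule pres_gen_closed)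

lemma gen_image: "U \<subseteq> A \<Longrightarrow> gen ` U \<subseteq> carrier G"
  by auto

lemma elem_closed: "w \<in> gwords A \<Longrightarrow> elem w \<in> carrier G"
  unfolding G_eq pc_group_def by (rule word_class_closed)

lemma word_val_gen: "w \<in> gwords A \<Longrightarrow> word_val G gen w = elem w"
  unfolding G_eq pc_group_def pc_gen_def by (rule word_val_pres_gen)

lemma elem_append: "u \<in> gwords A \<Longrightarrow> v \<in> gwords A \<Longrightarrow> elem (u @ v) = elem u \<otimes> elem v"
  unfolding G_eq pc_group_def by (rule word_class_mult[symmetric])

lemma elem_cases:
  assumes "g \<in> carrier G" obtains w where "w \<in> gwords A" "g = elem w"
  using assms presented_group_cases unfolding G_eq pc_group_def by metis

lemma gen_commute:
  assumes "{c, d} \<in> E" shows "gen c \<otimes> gen d = gen d \<otimes> gen c"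
proof -
  have cd: "gen c \<in> carrier G" "gen d \<in> carrier G" and A: "[Pos c, Pos d, Neg c, Neg d] \<in> gwords A"
    using E_D[OF assms] by (auto simp: gwords_iff)
  have "[Pos c, Pos d, Neg c, Neg d] \<in> commutator_rels E"
    using assms by (auto simp: commutator_rels_def)
  from pres_eq.rel[OF this A] have "elem [Pos c, Pos d, Neg c, Neg d] = elem []"
    by (rule word_class_eq)
  then have "gen c \<otimes> (gen d \<otimes> (inv gen c \<otimes> inv gen d)) = \<one>"
    using word_val_gen[OF A] word_val_gen[of "[]"] cd by simp
  then have "gen c \<otimes> gen d \<otimes> inv (gen d \<otimes> gen c) = \<one>"
    using cd by (simp add: inv_mult_group m_assoc)
  then show ?thesis
    using cd by (metis inv_closed inv_equality inv_inv m_closed)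
qed

lemma edge_group_subgroup: "subgroup (edge_group c) G"
  unfolding edge_group_def using link_subset by (intro generate_is_subgroup gen_image) blast

lemma edge_group_closed: "x \<in> edge_group c \<Longrightarrow> x \<in> carrier G"
  using subgroup.subset[OF edge_group_subgroup] by blast

lemma edge_group_commute:
  assumes "c \<in> A" "x \<in> edge_group c" shows "x \<otimes> gen c = gen c \<otimes> x"
proof (rule generate_commute[of "gen ` link c" "{gen c}"])
  show "s \<otimes> t = t \<otimes> s" if "s \<in> gen ` link c" "t \<in> {gen c}" for s t
    using that gen_commute by (auto simp: link_def)
  show "gen ` link c \<subseteq> carrier G"
    using link_subset by (intro gen_image) blast
qed (use assms in \<open>auto simp: edge_group_def intro: generate.incl\<close>)

lemma lcoset_Pow: "g \<in> carrier G \<Longrightarrow> U \<in> Pow (carrier G) \<Longrightarrow> g <# U \<in> Pow (carrier G)"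
  using l_coset_subset_G by blast

sublocale cosets: edge_action G "\<lambda>g U. g <# U" "Pow (carrier G)"
  by unfold_locales (auto simp: lcos_mult_one lcos_m_assoc intro: lcoset_Pow[THEN PowD, THEN subsetD])

abbreviation shift :: "'a gword set \<Rightarrow> 'a gword set set gword \<Rightarrow> 'a gword set set gword" where
  "shift \<equiv> cosets.translate"

text \<open>The geodesic of a single letter. The inverse of \<open>c\<close> traverses the edge backwards that ends at the base vertex, which is why
its coset is the translate of the edge group by \<open>inv (gen c)\<close>.\<close>

definition letter_path :: "'a \<Rightarrow> 'a letter \<Rightarrow> 'a gword set set gword" where
  "letter_path c l = (if l = Pos c then [Pos (edge_group c)]
     else if l = Neg c then [Neg (inv gen c <# edge_group c)] else [])"

primrec word_path :: "'a \<Rightarrow> 'a gword \<Rightarrow> 'a gword set set gword" where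
  "word_path c [] = []"
| "word_path c (l # w)
    = foldr free_cons (letter_path c l) (shift (letter_val G gen l) (word_path c w))"

lemma letter_val_gen_closed: "set_letter l \<subseteq> A \<Longrightarrow> letter_val G gen l \<in> carrier G"
  by (rule letter_val_closed[of gen A]) auto

lemma edge_group_Pow: "edge_group c \<in> Pow (carrier G)"
  using edge_group_closed by blast

lemma letter_path_gwords:
  assumes "c \<in> A" shows "letter_path c l \<in> gwords (Pow (carrier G))"
proof -
  have "inv gen c <# edge_group c \<in> Pow (carrier G)"
    using assms by (intro lcoset_Pow edge_group_Pow) simp
  then show ?thesis
    using edge_group_Pow[of c] by (auto simp: letter_path_def gwords_iff)
qed

lemma word_path_gwords:
  assumes "c \<in> A" "w \<in> gwords A" shows "word_path c w \<in> gwords (Pow (carrier G))"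
  using assms(2)
proof (induction w)
  case (Cons l w)
  then have "set_letter l \<subseteq> A" "w \<in> gwords A" by (auto simp: gwords_iff)
  then show ?case
    using Cons.IH foldr_free_cons_gwords letter_path_gwords[OF assms(1)] cosets.translate_gwords
      letter_val_gen_closed by (metis word_path.simps(2))
qed simp

lemma word_path_reduced:
  assumes "c \<in> A" "w \<in> gwords A" shows "freely_reduced (word_path c w)"
  using assms(2)
proof (induction w)
  case (Cons l w)
  then have l: "set_letter l \<subseteq> A" and w: "w \<in> gwords A" by (auto simp: gwords_iff)
  show ?case
    using freely_reduced_map[OF cosets.inj_act[OF letter_val_gen_closed[OF l]]
        word_path_gwords[OF assms(1) w] Cons.IH[OF w]]
    by (simp add: freely_reduced_foldr)
qed simp

lemma word_path_append:
  assumes c: "c \<in> A" and u: "u \<in> gwords A" and v: "v \<in> gwords A"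
  shows "word_path c (u @ v) = foldr free_cons (word_path c u) (shift (elem u) (word_path c v))"
  using u
proof (induction u)
  case Nil
  have "elem [] = \<one>" using word_val_gen[of "[]"] by simp
  then show ?case using cosets.translate_one[OF word_path_gwords[OF c v]] by simp
next
  case (Cons l u)
  then have l: "set_letter l \<subseteq> A" and u: "u \<in> gwords A" by (auto simp: gwords_iff)
  let ?g = "letter_val G gen l"
  note g = letter_val_gen_closed[OF l]
  have lu: "elem (l # u) = ?g \<otimes> elem u"
    using word_val_gen[OF Cons.prems] word_val_gen[OF u] by simp
  have red: "freely_reduced (shift (elem (l # u)) (word_path c v))"
    using freely_reduced_map[OF cosets.inj_act word_path_gwords[OF c v] word_path_reduced[OF c v]]
      elem_closed[OF Cons.prems] by blast
  have "word_path c ((l # u) @ v) = foldr free_cons (letter_path c l)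
      (shift ?g (foldr free_cons (word_path c u) (shift (elem u) (word_path c v))))"
    using Cons.IH[OF u] by simp
  also have "shift ?g (foldr free_cons (word_path c u) (shift (elem u) (word_path c v)))
      = foldr free_cons (shift ?g (word_path c u)) (shift (elem (l # u)) (word_path c v))"
    unfolding lu cosets.translate_mult[OF g elem_closed[OF u] word_path_gwords[OF c v]]
    by (intro map_foldr_free_cons[OF cosets.inj_act[OF g]] word_path_gwords c u v cosets.translate_gwords elem_closed)
  finally show ?case
    using foldr_foldr_free_cons[OF red] by simp
qed

text \<open>This makes the path well defined on group elements: the two edges of a commutator that involves \<open>c\<close> are equal cosets,
because the other letter lies in the edge group, and they cancel.\<close>

lemma word_path_commutator:
  assumes c: "c \<in> A" and E: "{a, b} \<in> E"
  shows "word_path c [Pos a, Pos b, Neg a, Neg b] = []"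
proof -
  have ab: "a \<in> A" "b \<in> A" "a \<noteq> b" using E_D[OF E] by auto
  note [simp] = ab c
  have P: "edge_group c \<subseteq> carrier G" "\<And>g U. g \<in> carrier G \<Longrightarrow> U \<subseteq> carrier G \<Longrightarrow> g <# U \<subseteq> carrier G"
    using edge_group_Pow l_coset_subset_G by auto
  consider "a = c" | "b = c" | "a \<noteq> c" "b \<noteq> c" by blast
  then show ?thesis
  proof cases
    case 1
    then have "gen b \<in> edge_group c"
      using E by (auto simp: edge_group_def link_def intro: generate.incl)
    then have coset: "gen b <# edge_group c = edge_group c"
      using coset_join3[OF _ edge_group_subgroup] by simp
    have "gen c <# (gen b <# (inv gen c <# edge_group c)) = (gen c \<otimes> gen b \<otimes> inv gen c) <# edge_group c"
      using P by (simp add: lcos_m_assoc m_assoc)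
    also have "gen c \<otimes> gen b \<otimes> inv gen c = gen b"
      using gen_commute[OF E] 1 by (simp add: m_assoc)
    finally show ?thesis
      using 1 ab(3) not_sym[OF ab(3)] coset by (simp add: letter_path_def free_cons_def)
  next
    case 2
    then have "inv gen a \<in> edge_group c"
      using E by (auto simp: edge_group_def link_def insert_commute intro: generate.inv)
    then have coset: "inv gen a <# edge_group c = edge_group c"
      using coset_join3[OF _ edge_group_subgroup] by simp
    have "gen c <# (inv gen a <# (inv gen c <# edge_group c))
        = (gen c \<otimes> inv gen a \<otimes> inv gen c) <# edge_group c"
      using P by (simp add: lcos_m_assoc m_assoc)
    also have "gen c \<otimes> inv gen a \<otimes> inv gen c = inv gen a"
    proof -
      have "inv (gen c \<otimes> gen a) = inv (gen a \<otimes> gen c)" using gen_commute[OF E] 2 by simp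
      then show ?thesis by (simp add: inv_mult_group m_assoc flip: m_assoc[of "gen c" "inv gen c"])
    qed
    finally show ?thesis
      using 2 ab(3) not_sym[OF ab(3)] coset by (simp add: letter_path_def free_cons_def)
  qed (simp add: letter_path_def)
qed

lemma word_path_pres_eq:
  assumes c: "c \<in> A" and "pres_eq A (commutator_rels E) u v"
  shows "word_path c u = word_path c v"
  using assms(2)
proof (induction rule: pres_eq.induct)
  case (cong u v p s)
  then show ?case
    using pres_eq_gwords[OF cong.hyps(1)] word_class_eq[OF cong.hyps(1)]
    by (simp add: word_path_append[OF c])
next
  case (cancel l)
  have "gen c <# (inv gen c <# edge_group c) = edge_group c"
    using c edge_group_Pow[of c] by (simp add: lcos_m_assoc lcos_mult_one)
  then show ?case
    by (cases l) (auto simp: letter_path_def free_cons_def)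
next
  case (rel r)
  then show ?case using word_path_commutator[OF c] by (auto simp: commutator_rels_def)
qed auto

text \<open>Any representing word may be chosen, by \<open>word_path_pres_eq\<close>.\<close>

definition path :: "'a \<Rightarrow> 'a gword set \<Rightarrow> 'a gword set set gword" where
  "path c g = word_path c (SOME w. w \<in> gwords A \<and> g = elem w)"

lemma path_elem:
  assumes "c \<in> A" "w \<in> gwords A" shows "path c (elem w) = word_path c w"
proof -
  have "\<exists>v. v \<in> gwords A \<and> elem w = elem v" using assms by blast
  from someI_ex[OF this]
  have "pres_eq A (commutator_rels E) w (SOME v. v \<in> gwords A \<and> elem w = elem v)"
    by (intro word_class_eqD) auto
  then show ?thesis
    unfolding path_def using word_path_pres_eq[OF assms(1)] by simp
qed

text \<open>Every vertex \<open>c\<close> yields such a cocycle. One vertex serves for the insertion, while the cocycles of all of them are used to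
control commutation.\<close>

lemma edge_cocycle_path:
  assumes "c \<in> A" shows "edge_cocycle G (\<lambda>g U. g <# U) (Pow (carrier G)) (path c)"
proof unfold_locales
  show "path c (g \<otimes> h) = foldr free_cons (path c g) (shift g (path c h))"
    if gh: "g \<in> carrier G" "h \<in> carrier G" for g h
  proof -
    obtain u v where "u \<in> gwords A" "g = elem u" "v \<in> gwords A" "h = elem v"
      using gh elem_cases by metis
    then show ?thesis
      using assms by (simp add: path_elem word_path_append flip: elem_append)
  qed
  show "path c g \<in> gwords (Pow (carrier G))" "freely_reduced (path c g)"
    if g: "g \<in> carrier G" for g
    using elem_cases[OF g] path_elem[OF assms] word_path_gwords[OF assms] word_path_reduced[OF assms]
    by metis+
qed

end

section \<open>Conjugates of edge groups\<close>

context partially_commutative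
begin

lemma path_mult:
  "c \<in> A \<Longrightarrow> g \<in> carrier G \<Longrightarrow> h \<in> carrier G \<Longrightarrow>
    path c (g \<otimes> h) = foldr free_cons (path c g) (shift g (path c h))"
  by (rule edge_cocycle.path_mult[OF edge_cocycle_path])

lemma path_one: "c \<in> A \<Longrightarrow> path c \<one> = []"
  by (rule edge_cocycle.path_one[OF edge_cocycle_path])

lemma path_inv_Nil: "c \<in> A \<Longrightarrow> g \<in> carrier G \<Longrightarrow> path c g = [] \<Longrightarrow> path c (inv g) = []"
  using edge_cocycle.path_inv[OF edge_cocycle_path] by (simp add: inv_word_def)

lemma path_gen:
  assumes "c \<in> A" "d \<in> A"
  shows "path c (gen d) = (if d = c then [Pos (edge_group c)] else [])"
proof -
  have "gen d = elem [Pos d]"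
    unfolding pc_gen_def by (rule pres_gen_eq)
  then show ?thesis
    using path_elem[OF assms(1), of "[Pos d]"] assms(2)
    by (simp add: gwords_iff letter_path_def free_cons_def)
qed

lemma path_generate:
  assumes "c \<in> A" "U \<subseteq> A - {c}" "x \<in> generate G (gen ` U)"
  shows "path c x = []"
  using assms(3)
proof (induction rule: generate.induct)
  case (eng g h)
  have "gen ` U \<subseteq> carrier G" using assms(2) by auto
  then have "g \<in> carrier G" "h \<in> carrier G" using eng generate_in_carrier by auto
  then show ?case using eng assms(1) by (simp add: path_mult)
qed (use assms path_one path_inv_Nil path_gen in \<open>auto 0 3 simp: subset_iff\<close>)

lemma path_edge_group:
  assumes "b \<in> A" "{c, b} \<notin> E" "x \<in> edge_group c"
  shows "path b x = []"
proof (rule path_generate[OF assms(1)])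
  show "link c \<subseteq> A - {b}"
    using link_subset assms(2) by (auto simp: link_def)
  show "x \<in> generate G (gen ` link c)"
    using assms(3) by (simp add: edge_group_def)
qed

text \<open>Elements whose paths contain no backward edge, for any vertex. Their paths simply concatenate, so
that an equation between products can be compared edge by edge.\<close>

definition positive :: "'a gword set \<Rightarrow> bool" where
  "positive g \<longleftrightarrow> g \<in> carrier G \<and> (\<forall>c\<in>A. \<forall>l\<in>set (path c g). \<exists>U. l = Pos U)"

lemma positive_closed: "positive g \<Longrightarrow> g \<in> carrier G"
  by (simp add: positive_def)

lemma path_mult_positive:
  assumes "c \<in> A" "positive g" "positive h"
  shows "path c (g \<otimes> h) = path c g @ shift g (path c h)"
proof -
  have "\<forall>l\<in>set (shift g (path c h)). \<exists>U. l = Pos U"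
    using assms by (fastforce simp: positive_def)
  then show ?thesis
    using assms path_mult[of c g h] foldr_free_cons_Pos[of "path c g" "shift g (path c h)"]
    by (auto simp: positive_def)
qed

lemma positive_one: "positive \<one>"
  by (simp add: positive_def path_one)

lemma positive_gen: "c \<in> A \<Longrightarrow> positive (gen c)"
  by (simp add: positive_def path_gen)

lemma positive_mult:
  assumes "positive g" "positive h" shows "positive (g \<otimes> h)"
  unfolding positive_def
proof (intro conjI ballI)
  fix c l assume "c \<in> A" "l \<in> set (path c (g \<otimes> h))"
  then show "\<exists>U. l = Pos U"
    using assms path_mult_positive[of c g h] by (fastforce simp: positive_def)
qed (use assms positive_closed in auto)

lemma path_mult_Nil_right:
  assumes "c \<in> A" "positive g" "y \<in> carrier G" "path c y = []"
  shows "path c (g \<otimes> y) = path c g"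
  using assms path_mult[of c g y] foldr_free_cons_Pos[of "path c g" "[]"]
  by (simp add: positive_def)

lemma mem_edge_group:
  assumes "x \<in> carrier G" "x <# edge_group c = edge_group c" shows "x \<in> edge_group c"
proof -
  have "\<one> \<in> edge_group c" by (rule subgroup.one_closed[OF edge_group_subgroup])
  then have "x \<otimes> \<one> \<in> x <# edge_group c" by (auto simp: l_coset_def)
  then show ?thesis using assms by simp
qed

text \<open>Both sides have a path that starts with an edge, namely the translate of the edge group by \<open>x\<close> and the edge group itself;
hence \<open>x\<close> lies in the edge group and commutes with \<open>gen c\<close>, which can then be cancelled.\<close>

lemma peel_left:
  assumes c: "c \<in> A" and x: "x \<in> carrier G" "path c x = []" and y: "y \<in> carrier G" "path c y = []"
    and w: "positive w" and eq: "x \<otimes> (gen c \<otimes> w) = gen c \<otimes> w \<otimes> y"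
  shows "x \<in> edge_group c" "x \<otimes> w = w \<otimes> y"
proof -
  note [simp] = positive_closed[OF w] c x(1) y(1)
  have cw: "path c (gen c \<otimes> w) = Pos (edge_group c) # shift (gen c) (path c w)"
    using path_mult_positive[OF c positive_gen[OF c] w] by (simp add: path_gen)
  have "path c (x \<otimes> (gen c \<otimes> w)) = shift x (path c (gen c \<otimes> w))"
    using x by (simp add: path_mult)
  moreover have "path c (gen c \<otimes> w \<otimes> y) = path c (gen c \<otimes> w)"
    using w y c by (intro path_mult_Nil_right positive_mult positive_gen)
  ultimately have "x <# edge_group c = edge_group c"
    using cw eq by simp
  then show x_edge: "x \<in> edge_group c" by (rule mem_edge_group[OF x(1)])
  have "gen c \<otimes> (x \<otimes> w) = gen c \<otimes> (w \<otimes> y)"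
    using eq edge_group_commute[OF c x_edge] by (simp flip: m_assoc)
  then show "x \<otimes> w = w \<otimes> y" by simp
qed

text \<open>Both paths consist of one edge. Comparing them shows that the conjugate of \<open>x\<close> by \<open>m\<close> lies in the edge group; it
commutes with \<open>gen c\<close> and therefore equals \<open>y\<close>.\<close>

lemma peel_right:
  assumes c: "c \<in> A" and x: "x \<in> carrier G" "path c x = []" and y: "y \<in> carrier G" "path c y = []"
    and m: "positive m" "path c m = []" and eq: "x \<otimes> (m \<otimes> gen c) = m \<otimes> gen c \<otimes> y"
  shows "y \<in> edge_group c" "x \<otimes> m = m \<otimes> y"
proof -
  note [simp] = positive_closed[OF m(1)] c x(1) y(1)
  define k where "k = inv m \<otimes> x \<otimes> m"
  have k: "k \<in> carrier G" "x \<otimes> m = m \<otimes> k"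
    by (simp_all add: k_def m_assoc flip: m_assoc[of m "inv m"])
  have mc: "path c (m \<otimes> gen c) = [Pos (m <# edge_group c)]"
    using path_mult_positive[OF c m(1) positive_gen[OF c]] m(2) by (simp add: path_gen)
  have "path c (x \<otimes> (m \<otimes> gen c)) = [Pos (x <# (m <# edge_group c))]"
    using x mc by (simp add: path_mult)
  moreover have "path c (m \<otimes> gen c \<otimes> y) = path c (m \<otimes> gen c)"
    using m y c by (intro path_mult_Nil_right positive_mult positive_gen)
  ultimately have "x <# (m <# edge_group c) = m <# edge_group c"
    using mc eq by simp
  then have "m <# (k <# edge_group c) = m <# edge_group c"
    using k edge_group_Pow[of c] by (simp add: lcos_m_assoc)
  then have "k <# edge_group c = edge_group c"
    using inj_onD[OF cosets.inj_act[of m]] edge_group_Pow lcoset_Pow[OF k(1)] by simp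
  then have k_edge: "k \<in> edge_group c" by (rule mem_edge_group[OF k(1)])
  have "m \<otimes> gen c \<otimes> y = x \<otimes> m \<otimes> gen c" using eq by (simp add: m_assoc)
  also have "\<dots> = m \<otimes> gen c \<otimes> k"
    using k edge_group_commute[OF c k_edge] by (simp add: m_assoc)
  finally have "y = k" using k(1) by simp
  then show "y \<in> edge_group c" "x \<otimes> m = m \<otimes> y" using k k_edge by auto
qed

text \<open>An order in which the vertices outside \<open>D\<close> are reached from \<open>D\<close> in the complement of the graph.\<close>

fun linked :: "'a set \<Rightarrow> 'a list \<Rightarrow> bool" where
  "linked D [] \<longleftrightarrow> True"
| "linked D (b # bs) \<longleftrightarrow> b \<in> A \<and> b \<notin> D \<and> (\<exists>d\<in>D. {d, b} \<notin> E) \<and> linked (insert b D) bs"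

primrec palindrome :: "'a list \<Rightarrow> 'a gword set" where
  "palindrome [] = \<one>"
| "palindrome (b # bs) = gen b \<otimes> (palindrome bs \<otimes> gen b)"

lemma linked_set: "linked D bs \<Longrightarrow> set bs \<subseteq> A - D"
  by (induction bs arbitrary: D) auto

lemma positive_palindrome: "set bs \<subseteq> A \<Longrightarrow> positive (palindrome bs)"
  by (induction bs) (auto intro: positive_one positive_mult positive_gen)

lemma path_palindrome:
  assumes "c \<in> A" "set bs \<subseteq> A - {c}" shows "path c (palindrome bs) = []"
  using assms(2)
proof (induction bs)
  case (Cons b bs)
  then have "palindrome bs \<in> carrier G"
    by (intro positive_closed[OF positive_palindrome]) auto
  then show ?case using Cons assms(1) by (simp add: path_mult path_gen)
qed (simp add: path_one assms(1))

text \<open>The outermost letter \<open>b\<close> is not joined to some \<open>d\<close> in \<open>D\<close>. As \<open>x\<close> and \<open>y\<close> lie in the edge group of \<open>d\<close>,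
they do not involve \<open>b\<close>, and both copies of \<open>b\<close> can be peeled off. This puts \<open>x\<close> and \<open>y\<close> into the edge group of \<open>b\<close>
as well, so \<open>b\<close> can join \<open>D\<close>. Peeling on one side only would control only one of \<open>x\<close> and \<open>y\<close>.\<close>

lemma palindrome_conjugation:
  assumes "linked D bs" "x \<in> carrier G" "y \<in> carrier G"
    and "\<forall>d\<in>D. x \<in> edge_group d \<and> y \<in> edge_group d"
    and "x \<otimes> palindrome bs = palindrome bs \<otimes> y"
  shows "\<forall>d\<in>D \<union> set bs. x \<in> edge_group d"
  using assms
proof (induction bs arbitrary: D)
  case (Cons b bs)
  let ?m = "palindrome bs"
  have b: "b \<in> A" "b \<notin> D" and bs: "linked (insert b D) bs" using Cons.prems(1) by auto
  then have set_bs: "set bs \<subseteq> A - {b}" "set bs \<subseteq> A" using linked_set by blast+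
  note m = positive_palindrome[OF set_bs(2)] path_palindrome[OF b(1) set_bs(1)]
  obtain d where "d \<in> D" "{d, b} \<notin> E" using Cons.prems(1) by auto
  then have xy: "path b x = []" "path b y = []"
    using Cons.prems(4) path_edge_group[OF b(1)] by blast+
  have pos: "positive (?m \<otimes> gen b)"
    using m b by (intro positive_mult positive_gen)
  have eq: "x \<otimes> (gen b \<otimes> (?m \<otimes> gen b)) = gen b \<otimes> (?m \<otimes> gen b) \<otimes> y"
    using Cons.prems(5) by simp
  note left = peel_left[OF b(1) Cons.prems(2) xy(1) Cons.prems(3) xy(2) pos eq]
  note right = peel_right[OF b(1) Cons.prems(2) xy(1) Cons.prems(3) xy(2) m left(2)]
  show ?case
    using Cons.IH[OF bs Cons.prems(2,3) _ right(2)] Cons.prems(4) left(1) right(1) by simp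
qed auto

text \<open>The retraction that kills \<open>c\<close> fixes the edge group of \<open>c\<close>, so that it fixes \<open>x\<close>; its image of the second
subgroup avoids \<open>c\<close>.\<close>

lemma generate_delete:
  assumes c: "c \<in> A" and B: "B \<subseteq> A" and x: "x \<in> edge_group c" "x \<in> generate G (gen ` B)"
  shows "x \<in> generate G (gen ` (B - {c}))"
proof -
  define f where "f d = (if d = c then \<one> else gen d)" for d
  have f: "f ` A \<subseteq> carrier G" by (auto simp: f_def)
  have "word_val G f r = \<one>" if r: "r \<in> commutator_rels E" for r
  proof -
    obtain a b where ab: "r = [Pos a, Pos b, Neg a, Neg b]" "{a, b} \<in> E"
      using r by (auto simp: commutator_rels_def)
    then have A: "gen a \<in> carrier G" "gen b \<in> carrier G" using E_D by auto
    have "gen a \<otimes> (gen b \<otimes> (inv gen a \<otimes> inv gen b)) = gen a \<otimes> gen b \<otimes> inv (gen b \<otimes> gen a)"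
      using A by (simp add: inv_mult_group m_assoc)
    also have "\<dots> = \<one>" using gen_commute[OF ab(2)] A by simp
    finally show ?thesis using ab(1) A by (auto simp: f_def)
  qed
  then obtain \<phi> where \<phi>: "\<phi> \<in> hom G G" "\<And>d. d \<in> A \<Longrightarrow> \<phi> (gen d) = f d"
    using presented_group_hom[OF group_axioms f, of "commutator_rels E"]
    unfolding G_eq pc_group_def pc_gen_def by metis
  interpret \<phi>: group_hom G G \<phi> by unfold_locales (rule \<phi>(1))
  have "\<phi> x = x"
    using x(1) unfolding edge_group_def
  proof (induction rule: generate.induct)
    case (eng g h)
    then show ?case using generate_in_carrier[OF gen_image] link_subset[of c] by (metis Diff_subset \<phi>.hom_mult order_trans)
  qed (use \<phi>(2) link_subset[of c] in \<open>auto simp: f_def subset_iff\<close>)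
  moreover have "\<phi> x \<in> generate G (gen ` (B - {c}))"
    using x(2)
  proof (induction rule: generate.induct)
    case (incl g)
    then obtain d where "d \<in> B" "g = gen d" by blast
    then show ?case
      using \<phi>(2)[of d] c B by (cases "d = c") (auto simp: f_def intro: generate.incl generate.one)
  next
    case (inv g)
    then obtain d where "d \<in> B" "g = gen d" by blast
    then show ?case
      using \<phi>(2)[of d] c B
      by (cases "d = c") (auto simp: f_def subset_iff intro: generate.inv generate.one)
  next
    case (eng g h)
    then show ?case using generate_in_carrier[OF gen_image[OF B]] by (simp add: generate.eng)
  qed (simp add: generate.one)
  ultimately show ?thesis by simp
qed

lemma generate_gen: "generate G (gen ` A) = carrier G"
proof
  show "carrier G \<subseteq> generate G (gen ` A)"
  proof
    fix g assume "g \<in> carrier G"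
    then obtain w where w: "w \<in> gwords A" "g = elem w" by (rule elem_cases)
    have "word_val G gen w \<in> generate G (gen ` A)"
      using w(1)
    proof (induction w)
      case (Cons l w)
      then show ?case
        by (cases l) (auto simp: gwords_iff intro!: generate.eng intro: generate.incl generate.inv)
    qed (simp add: generate.one)
    then show "g \<in> generate G (gen ` A)" using w word_val_gen by simp
  qed
qed (use generate_in_carrier[OF gen_image] in blast)

text \<open>By \<open>generate_delete\<close>, the vertices can be removed one after the other from the words that represent \<open>x\<close>.\<close>

lemma edge_groups_trivial:
  assumes "x \<in> carrier G" "\<forall>c\<in>A. x \<in> edge_group c"
  shows "x = \<one>"
proof -
  have "finite A" using graph by (simp add: finite_simple_graph_def)
  have "x \<in> generate G (gen ` (A - B))" if "finite B" "B \<subseteq> A" for B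
    using that
  proof (induction B)
    case empty
    then show ?case using assms(1) generate_gen by simp
  next
    case (insert c B)
    then have "x \<in> generate G (gen ` (A - B - {c}))"
      using assms(2) by (intro generate_delete) auto
    moreover have "A - B - {c} = A - insert c B" by blast
    ultimately show ?case by simp
  qed
  from this[OF \<open>finite A\<close>] show ?thesis by (simp add: generate_empty)
qed

section \<open>Direct indecomposability\<close>

lemma gen_neq_one: "c \<in> A \<Longrightarrow> gen c \<noteq> \<one>"
  using path_gen[of c c] path_one[of c] by auto

text \<open>If the graph is a join, then \<open>G\<close> is the internal direct product of the subgroups generated by the two
parts: they commute, and an element of both lies in every edge group.\<close>

lemma join_decomposes:
  assumes D: "D \<subseteq> A" "D \<noteq> {}" "A - D \<noteq> {}" and join: "\<And>c d. c \<in> D \<Longrightarrow> d \<in> A - D \<Longrightarrow> {c, d} \<in> E"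
  shows "\<not> directly_indecomposable G"
proof -
  let ?H = "generate G (gen ` D)" and ?K = "generate G (gen ` (A - D))"
  have img: "gen ` D \<subseteq> carrier G" "gen ` (A - D) \<subseteq> carrier G"
    using D(1) by auto
  note sub = generate_is_subgroup[OF img(1)] generate_is_subgroup[OF img(2)]
  note closed = generate_in_carrier[OF img(1)] generate_in_carrier[OF img(2)]
  have comm: "h \<otimes> k = k \<otimes> h" if "h \<in> ?H" "k \<in> ?K" for h k
    using generate_commute[OF img _ that] join gen_commute by blast
  have triv: "x = \<one>" if "x \<in> ?H" "x \<in> ?K" for x
  proof (rule edge_groups_trivial)
    show "\<forall>c\<in>A. x \<in> edge_group c"
    proof
      fix c assume "c \<in> A"
      show "x \<in> edge_group c"
      proof (cases "c \<in> D")
        case True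
        then have "gen ` (A - D) \<subseteq> gen ` link c"
          using join by (auto simp: link_def)
        then show ?thesis
          using that(2) mono_generate unfolding edge_group_def by blast
      next
        case False
        then have "gen ` D \<subseteq> gen ` link c"
          using join \<open>c \<in> A\<close> by (auto simp: link_def insert_commute)
        then show ?thesis
          using that(1) mono_generate unfolding edge_group_def by blast
      qed
    qed
  qed (use that closed in blast)
  let ?f = "\<lambda>(h, k). h \<otimes> k"
  let ?P = "G\<lparr>carrier := ?H\<rparr> \<times>\<times> G\<lparr>carrier := ?K\<rparr>"
  have f_hom: "?f \<in> hom ?P G"
  proof (rule homI)
    fix p q assume "p \<in> carrier ?P" "q \<in> carrier ?P"
    then obtain h k h' k' where pq: "p = (h, k)" "q = (h', k')"
      and mem: "h \<in> ?H" "k \<in> ?K" "h' \<in> ?H" "k' \<in> ?K" by auto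
    note c = closed(1)[OF mem(1)] closed(2)[OF mem(2)] closed(1)[OF mem(3)] closed(2)[OF mem(4)]
    have "h \<otimes> h' \<otimes> (k \<otimes> k') = h \<otimes> (h' \<otimes> k) \<otimes> k'" using c by (simp add: m_assoc)
    also have "\<dots> = h \<otimes> k \<otimes> (h' \<otimes> k')" using comm[OF mem(3,2)] c by (simp add: m_assoc)
    finally show "?f (p \<otimes>\<^bsub>?P\<^esub> q) = ?f p \<otimes> ?f q" using pq by simp
  qed (use closed in auto)
  have P: "group ?P"
    using sub[THEN subgroup.subgroup_is_group] by (intro DirProd_group) (auto simp: group_axioms)
  interpret f: group_hom ?P G ?f
    using P f_hom by (simp add: group_hom_def group_hom_axioms_def group_axioms)
  have inj: "inj_on ?f (carrier ?P)"
    unfolding f.inj_on_one_iff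
  proof safe
    fix h k assume "(h, k) \<in> carrier ?P" "h \<otimes> k = \<one>"
    then have mem: "h \<in> ?H" "k \<in> ?K" "h \<otimes> k = \<one>" by auto
    then have "h = inv k" using closed inv_equality by metis
    then have "h \<in> ?K" using subgroup.m_inv_closed[OF sub(2) mem(2)] by simp
    then have "h = \<one>" using triv mem(1) by blast
    then show "(h, k) = \<one>\<^bsub>?P\<^esub>" using mem closed(2) by simp
  qed
  have "carrier G \<subseteq> ?f ` carrier ?P"
  proof -
    have "gen c \<in> ?f ` carrier ?P" if "c \<in> A" for c
    proof (cases "c \<in> D")
      case True
      then have "(gen c, \<one>) \<in> carrier ?P" by (auto intro: generate.incl generate.one)
      then show ?thesis using that by (force intro: rev_image_eqI)
    next
      case False
      then have "(\<one>, gen c) \<in> carrier ?P" using that by (auto intro: generate.incl generate.one)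
      then show ?thesis using that by (force intro: rev_image_eqI)
    qed
    then have "gen ` A \<subseteq> ?f ` carrier ?P" by blast
    then have "generate G (gen ` A) \<subseteq> ?f ` carrier ?P"
      by (rule generate_subgroup_incl) (rule f.img_is_subgroup)
    then show ?thesis by (simp only: generate_gen)
  qed
  then have "?f \<in> iso ?P G"
    using inj f_hom closed by (auto simp: iso_def bij_betw_def)
  then have iso: "?P \<cong> G" by (auto simp: is_iso_def)
  have nontriv: "generate G (gen ` U) \<noteq> {\<one>}" if U: "U \<subseteq> A" "U \<noteq> {}" for U
  proof -
    obtain c where c: "c \<in> U" using U(2) by blast
    then have "gen c \<in> generate G (gen ` U)" by (intro generate.incl imageI)
    moreover have "gen c \<noteq> \<one>" using gen_neq_one c U(1) by blast
    ultimately show ?thesis by auto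
  qed
  have "carrier (G\<lparr>carrier := ?H\<rparr>) \<noteq> {\<one>\<^bsub>G\<lparr>carrier := ?H\<rparr>\<^esub>}"
    "carrier (G\<lparr>carrier := ?K\<rparr>) \<noteq> {\<one>\<^bsub>G\<lparr>carrier := ?K\<rparr>\<^esub>}"
    using nontriv[of D] nontriv[of "A - D"] D by auto
  then show ?thesis
    using iso sub[THEN subgroup.subgroup_is_group, OF group_axioms]
    unfolding directly_indecomposable_def by blast
qed

lemma linked_exists:
  assumes "directly_indecomposable G" "D \<subseteq> A" "D \<noteq> {}"
  shows "\<exists>bs. linked D bs \<and> set bs = A - D"
  using assms(2,3)
proof (induction "card (A - D)" arbitrary: D)
  case 0
  have "finite A" using graph by (simp add: finite_simple_graph_def)
  then have "A - D = {}" using 0 by simp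
  then show ?case by (intro exI[of _ "[]"]) simp
next
  case (Suc n)
  then have "A - D \<noteq> {}" by (metis card.empty nat.distinct(1))
  then obtain d b where db: "d \<in> D" "b \<in> A - D" "{d, b} \<notin> E"
    using join_decomposes[OF Suc.prems] assms(1) by blast
  have "A - insert b D = A - D - {b}" by blast
  then have "card (A - insert b D) = n"
    using Suc.hyps(2) db(2) by simp
  then obtain bs where "linked (insert b D) bs" "set bs = A - insert b D"
    using Suc.hyps(1)[of "insert b D"] Suc.prems(1) db(2) by auto
  then show ?case
    using db Suc.prems(1) by (intro exI[of _ "b # bs"]) auto
qed

lemma nonadjacent_exist:
  assumes "\<not> comm_group G"
  obtains a b where "a \<in> A" "b \<in> A" "a \<noteq> b" "{a, b} \<notin> E"
proof -
  have "\<exists>a\<in>A. \<exists>b\<in>A. a \<noteq> b \<and> {a, b} \<notin> E"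
  proof (rule ccontr)
    assume *: "\<not> ?thesis"
    have "gen a \<otimes> gen b = gen b \<otimes> gen a" if "a \<in> A" "b \<in> A" for a b
      using that * gen_commute by (cases "a = b") blast+
    then have "x \<otimes> y = y \<otimes> x" if "x \<in> carrier G" "y \<in> carrier G" for x y
      using generate_commute[OF gen_image[OF subset_refl] gen_image[OF subset_refl], of x y] that
      unfolding generate_gen by blast
    then show False using assms by (simp add: group.group_comm_groupI group_axioms)
  qed
  then show thesis using that by blast
qed

section \<open>Free corners\<close>

text \<open>The elements are \<open>t n = a b\<^sup>n p\<close>, where \<open>p\<close> is the palindrome of a linked order of all the vertices
other than \<open>a\<close>. Multiplying by powers of \<open>b\<close> on the left keeps the peeling argument intact and separates the
double cosets of the edge group of \<open>a\<close>, since elements of that group have no edges in their \<open>b\<close>-paths.\<close>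

lemma corner_elements:
  assumes indec: "directly_indecomposable G" and ab: "a \<in> A" "b \<in> A" "a \<noteq> b" "{a, b} \<notin> E"
  obtains t :: "nat \<Rightarrow> 'a gword set" where "\<And>n. t n \<in> carrier G" "\<And>n. path a (t n) = [Pos (edge_group a)]"
    "\<And>g m n. g \<in> carrier G \<Longrightarrow> g <# edge_group a = edge_group a \<Longrightarrow>
      g <# (t m <# edge_group a) = t n <# edge_group a \<Longrightarrow> m = n \<and> g = \<one>"
proof -
  obtain bs where bs: "linked {a} bs" "set bs = A - {a}"
    using linked_exists[OF indec, of "{a}"] ab(1) by auto
  let ?C = "edge_group a"
  define p where "p n = gen b [^] (n::nat) \<otimes> palindrome bs" for n
  have pow_b: "positive (gen b [^] (n::nat))" for n
  proof (induction n)
    case (Suc n)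
    then show ?case using ab(2) by (simp add: positive_mult positive_gen)
  qed (simp add: positive_one)
  have pal: "positive (palindrome bs)"
    using bs(2) by (intro positive_palindrome) auto
  have p_pos: "positive (p n)" for n
    unfolding p_def using pow_b pal by (rule positive_mult)
  have p_Suc: "p (Suc n) = gen b \<otimes> p n" for n
    using ab(2) positive_closed[OF pal] unfolding p_def nat_pow_Suc2[OF gen_closed[OF ab(2)]]
    by (simp add: m_assoc)
  have p_closed [simp]: "p n \<in> carrier G" for n using p_pos positive_closed by blast
  have path_p: "path a (p n) = []" for n
  proof (induction n)
    case 0
    then show ?case
      using path_palindrome[OF ab(1)] bs(2) positive_closed[OF pal] by (simp add: p_def)
  next
    case (Suc n)
    then show ?case using ab by (simp add: p_Suc path_mult path_gen)
  qed
  have len_p: "length (path b (p n)) = n + length (path b (p 0))" for n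
  proof (induction n)
    case (Suc n)
    then show ?case
      using path_mult_positive[OF ab(2) positive_gen[OF ab(2)] p_pos[of n]] ab(2)
      by (simp add: p_Suc path_gen)
  qed simp
  have C: "x \<in> carrier G" "path b x = []" "gen a \<otimes> x = x \<otimes> gen a" if "x \<in> ?C" for x
    using that edge_group_closed path_edge_group[OF ab(2,4)] edge_group_commute[OF ab(1)] by auto
  have conj_triv: "x = \<one>" if x: "x \<in> ?C" and y: "y \<in> ?C" and eq: "x \<otimes> p n = p n \<otimes> y" for x y n
    using eq
  proof (induction n)
    case 0
    then have "x \<otimes> palindrome bs = palindrome bs \<otimes> y"
      using positive_closed[OF pal] by (simp add: p_def)
    then have "\<forall>d\<in>{a} \<union> set bs. x \<in> edge_group d"
      using C x y by (intro palindrome_conjugation[OF bs(1)]) auto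
    moreover have "{a} \<union> set bs = A" using bs(2) ab(1) by auto
    ultimately show ?case
      using C(1)[OF x] edge_groups_trivial by metis
  next
    case (Suc n)
    then have "x \<otimes> (gen b \<otimes> p n) = gen b \<otimes> p n \<otimes> y" by (simp add: p_Suc)
    then show ?case
      using Suc.IH peel_left(2)[OF ab(2) C(1,2)[OF x] C(1,2)[OF y] p_pos] by blast
  qed
  show thesis
  proof (rule that[of "\<lambda>n. gen a \<otimes> p n"])
    show "gen a \<otimes> p n \<in> carrier G" for n using ab(1) by simp
    show "path a (gen a \<otimes> p n) = [Pos ?C]" for n
      using ab(1) path_p by (simp add: path_mult path_gen free_cons_def)
    fix g m n
    assume g: "g \<in> carrier G" "g <# ?C = ?C"
      and eq: "g <# ((gen a \<otimes> p m) <# ?C) = (gen a \<otimes> p n) <# ?C"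
    have gC: "g \<in> ?C" using g by (rule mem_edge_group)
    have "gen a <# ((g \<otimes> p m) <# ?C) = (gen a \<otimes> g \<otimes> p m) <# ?C"
      using g(1) ab(1) edge_group_Pow[of a] by (simp add: lcos_m_assoc m_assoc)
    also have "\<dots> = (g \<otimes> (gen a \<otimes> p m)) <# ?C"
      using g(1) ab(1) C(3)[OF gC] by (simp add: m_assoc)
    also have "\<dots> = gen a <# (p n <# ?C)"
      using eq g(1) ab(1) edge_group_Pow[of a] by (simp add: lcos_m_assoc)
    finally have "(g \<otimes> p m) <# ?C = p n <# ?C"
      using inj_onD[OF cosets.inj_act[OF gen_closed[OF ab(1)]]] edge_group_Pow[of a] lcoset_Pow g(1)
      by (metis m_closed p_closed)
    moreover have "p n \<otimes> \<one> \<in> p n <# ?C"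
      using subgroup.one_closed[OF edge_group_subgroup[of a]] unfolding l_coset_def by blast
    ultimately have "p n \<in> (g \<otimes> p m) <# ?C" by simp
    then obtain y where y: "y \<in> ?C" "p n = g \<otimes> p m \<otimes> y"
      by (auto simp: l_coset_def)
    \<comment> \<open>Equal numbers of \<open>b\<close>-edges force equal exponents.\<close>
    have "path b (p n) = shift g (path b (p m))"
      using path_mult_Nil_right[OF ab(2) p_pos C(1,2)[OF y(1)]] y(2) g(1) C(1)[OF y(1)] C(2)[OF gC] ab(2)
      by (simp add: m_assoc path_mult)
    then have mn: "m = n" using len_p[of m] len_p[of n] by simp
    have "g \<otimes> p n = p n \<otimes> inv y"
      using y mn g(1) C(1)[OF y(1)] by (metis inv_solve_right m_closed p_closed)
    then have "g = \<one>"
      using conj_triv[OF gC subgroup.m_inv_closed[OF edge_group_subgroup y(1)]] by blast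
    then show "m = n \<and> g = \<one>" using mn by simp
  qed
qed

end

section \<open>Formal solutions over partially commutative groups\<close>

theorem theorem7p6:
  fixes A :: "'a set" and E :: "'a set set" and k :: nat and S :: "'a eqn_symbol gword"
  defines "G \<equiv> pc_group A E"
    and "F \<equiv> free_grp {..<k}"
  defines "GX \<equiv> free_product G F"
    and "x \<equiv> (\<lambda>i. fp_inr G F (free_gen {..<k} i))"
  assumes "finite_simple_graph A E"
    and "\<not> comm_group G"
    and "directly_indecomposable G"
    and "S \<in> gwords (eqn_symbols k A)"
    and "forall_exists (carrier G) k
           (\<lambda>xs ys. word_val G (assign (pc_gen A E) xs ys) S = \<one>\<^bsub>G\<^esub>)"
  shows "\<exists>q. length q = k \<and>
           (\<forall>i<k. q ! i \<in> generate GX (fp_inl G F ` carrier G \<union> x ` {..i})) \<and>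
           word_val GX (assign (\<lambda>a. fp_inl G F (pc_gen A E a)) (map x [0..<k]) q) S = \<one>\<^bsub>GX\<^esub>"
proof -
  interpret partially_commutative A E G
    using assms(5) by unfold_locales (simp_all add: G_def)
  obtain a b where ab: "a \<in> A" "b \<in> A" "a \<noteq> b" "{a, b} \<notin> E"
    using nonadjacent_exist[OF assms(6)] by blast
  obtain t :: "nat \<Rightarrow> 'a gword set" where t: "\<And>n. t n \<in> carrier G" "\<And>n. path a (t n) = [Pos (edge_group a)]"
    "\<And>g m n. g \<in> carrier G \<Longrightarrow> g <#\<^bsub>G\<^esub> edge_group a = edge_group a \<Longrightarrow>
      g <#\<^bsub>G\<^esub> (t m <#\<^bsub>G\<^esub> edge_group a) = t n <#\<^bsub>G\<^esub> edge_group a \<Longrightarrow> m = n \<and> g = \<one>\<^bsub>G\<^esub>"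
    using corner_elements[OF assms(7) ab] by blast
  interpret GX: group GX
    unfolding GX_def free_product_def by (rule group_presented_group)
  interpret corner_family G "\<lambda>g U. g <#\<^bsub>G\<^esub> U" "Pow (carrier G)" "path a" GX "fp_inl G F"
    "edge_group a" t
    using edge_cocycle_path[OF ab(1)] fp_inl_hom[OF group_axioms, of F] GX.group_axioms
      edge_group_Pow[of a] t
    by (simp add: corner_family_def corner_family_axioms_def GX_def)
  have "x i \<in> carrier GX" if "i < k" for i
    unfolding x_def GX_def free_product_def fp_inr_def F_def free_grp_def free_gen_def
    using that by (intro pres_gen_closed InrI pres_gen_closed) simp
  moreover have "finite A"
    using assms(5) by (simp add: finite_simple_graph_def)
  ultimately show ?thesis
    using formal_solution[OF _ gen_image[OF subset_refl] assms(8) _ assms(9), of x] by (simp add: comp_def)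
qed

end
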